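(* Let $\Omega\subset\mathbb R^d$ be a bounded domain, $Y$ a Hilbert space, and $A:L^1(\Omega)\to Y$ a bounded linear operator. Let $\Delta$ be the set of probability densities in $L^1(\Omega)$, let $f$ be the negative Boltzmann–Shannon entropy, let $\delta_\Delta$ be the indicator function of $\Delta$, and put $\mathcal R:=f+\delta_\Delta$ on $L^1(\Omega)$. Let $y\in Y$ be such that $Ax=y$ has a solution $x$ with $\mathcal R(x)<\infty$, and let $x^\dagger$ be the unique solution of $\min\{\mathcal R(x):x\in L^1(\Omega),\ Ax=y\}$. For $\delta>0$ and $y^\delta\in Y$ with $\|y^\delta-y\|\le\delta$, consider the entropic dual gradient method with $\lambda_0=0$: $$x_n=\frac{1}{\int_\Omega e^{A^*\lambda_n}}\,e^{A^*\lambda_n},\qquad \lambda_{n+1}=\lambda_n-\gamma(Ax_n-y^\delta),\qquad n\ge0.$$ (i) If $0<\gamma\le1/\|A\|^2$, then for integers $n_\delta$ satisfying $n_\delta\to\infty$ and $\delta^2n_\delta\to0$ as $\delta\to0$ there holds $\|x_{n_\delta}-x^\dagger\|_{L^1(\Omega)}\to0$ as $\delta\to0$. If in addition $x^\dagger$ satisfies the source condition $$1+\log x^\dagger=A^*\lambda^\dagger\quad\text{for some }\lambda^\dagger\in Y,$$ then with the choice $n_\delta\sim\delta^{-1}$ one has $\|x_{n_\delta}-x^\dagger\|_{L^1(\Omega)}=O(\delta^{1/2})$. (ii) If $\tau>1$ and $\gamma>0$ are chosen such that $1-2/\tau-\|A\|^2\gamma>0$, then the discrepancy principle $$\|Ax_{n_\delta}-y^\delta\|\le\tau\delta<\|Ax_n-y^\delta\|,\qquad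 0\le n<n_\delta,$$ defines a finite integer $n_\delta$, and $\|x_{n_\delta}-x^\dagger\|_{L^1(\Omega)}\to0$ as $\delta\to0$. If in addition $x^\dagger$ satisfies the source condition $1+\log x^\dagger=A^*\lambda^\dagger$ for some $\lambda^\dagger\in Y$, then $\|x_{n_\delta}-x^\dagger\|_{L^1(\Omega)}=O(\delta^{1/2})$.
   Context: All spaces are real. $\Delta=\{x\in L^1(\Omega):x\ge0\text{ a.e. on }\Omega,\ \int_\Omega x=1\}$; $\delta_\Delta(x)=0$ if $x\in\Delta$ and $\infty$ otherwise. $f(x)=\int_\Omega x\log x$ if $x\in L^1(\Omega)$, $x\ge0$ a.e. and $x\log x\in L^1(\Omega)$ (with $0\log0=0$), and $f(x)=\infty$ otherwise. $A^*:Y\to L^1(\Omega)^*=L^\infty(\Omega)$ is the adjoint of $A$, and $\|A\|$ is the operator norm from $L^1(\Omega)$ to $Y$. The source condition is an equality of functions a.e. on $\Omega$. The iterates depend on $y^\delta$ (and hence on $\delta$). $n_\delta\sim\delta^{-1}$ means that $n_\delta$ is an integer lying between two fixed positive multiples of $\delta^{-1}$; $O(\cdot)$ is understood as $\delta\to0$, with constants independent of $\delta$ and of the particular $y^\delta$. *)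

theory Defs
  imports "HOL-Analysis.Analysis"
begin

text \<open>
  Elements of \<open>L\<^sup>1(\<Omega>)\<close> are represented by Lebesgue integrable functions; two functions that
  agree almost everywhere on \<open>\<Omega>\<close> represent the same element.
\<close>

definition L1 :: "'a::euclidean_space set \<Rightarrow> ('a \<Rightarrow> real) set" where
  "L1 \<Omega> = {x. integrable (lebesgue_on \<Omega>) x}"

definition L1_norm :: "'a::euclidean_space set \<Rightarrow> ('a \<Rightarrow> real) \<Rightarrow> real" where
  "L1_norm \<Omega> x = (LINT t|lebesgue_on \<Omega>. \<bar>x t\<bar>)"

definition Linfty :: "'a::euclidean_space set \<Rightarrow> ('a \<Rightarrow> real) set" where
  "Linfty \<Omega> = {g \<in> borel_measurable (lebesgue_on \<Omega>). \<exists>C. AE t in lebesgue_on \<Omega>. \<bar>g t\<bar> \<le> C}"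

definition bounded_domain :: "'a::euclidean_space set \<Rightarrow> bool" where
  "bounded_domain \<Omega> \<longleftrightarrow> open \<Omega> \<and> connected \<Omega> \<and> \<Omega> \<noteq> {} \<and> bounded \<Omega>"

text \<open>
  Together with linearity, the norm bound forces \<open>A x = A x'\<close> whenever \<open>x = x'\<close> almost everywhere
  on \<open>\<Omega>\<close>, so such an \<open>A\<close> is an operator on equivalence classes.
\<close>

definition bounded_linear_L1 ::
    "'a::euclidean_space set \<Rightarrow> (('a \<Rightarrow> real) \<Rightarrow> 'b::real_normed_vector) \<Rightarrow> bool" where
  "bounded_linear_L1 \<Omega> A \<longleftrightarrow>
     (\<forall>x\<in>L1 \<Omega>. \<forall>x'\<in>L1 \<Omega>. A (\<lambda>t. x t + x' t) = A x + A x') \<and>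
     (\<forall>c. \<forall>x\<in>L1 \<Omega>. A (\<lambda>t. c * x t) = c *\<^sub>R A x) \<and>
     (\<exists>K. \<forall>x\<in>L1 \<Omega>. norm (A x) \<le> K * L1_norm \<Omega> x)"

text \<open>As in \<^const>\<open>onorm\<close>, the quotient is \<open>0\<close> for \<open>x = 0\<close> almost everywhere.\<close>

definition L1_onorm ::
    "'a::euclidean_space set \<Rightarrow> (('a \<Rightarrow> real) \<Rightarrow> 'b::real_normed_vector) \<Rightarrow> real" where
  "L1_onorm \<Omega> A = (SUP x\<in>L1 \<Omega>. norm (A x) / L1_norm \<Omega> x)"

text \<open>
  The dual of \<open>L\<^sup>1(\<Omega>)\<close> is identified with \<open>L\<^sup>\<infinity>(\<Omega>)\<close>: \<open>A\<^sup>* l\<close> is the element of \<open>L\<^sup>\<infinity>(\<Omega>)\<close> representing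
  the functional \<open>x \<mapsto> \<langle>l, A x\<rangle>\<close>. It is determined only up to null sets, and the choice operator
  picks a representative.
\<close>

definition L1_adjoint ::
    "'a::euclidean_space set \<Rightarrow> (('a \<Rightarrow> real) \<Rightarrow> 'b::real_inner) \<Rightarrow> 'b \<Rightarrow> 'a \<Rightarrow> real" where
  "L1_adjoint \<Omega> A l =
     (SOME g. g \<in> Linfty \<Omega> \<and> (\<forall>x\<in>L1 \<Omega>. (LINT t|lebesgue_on \<Omega>. g t * x t) = inner l (A x)))"

definition prob_densities :: "'a::euclidean_space set \<Rightarrow> ('a \<Rightarrow> real) set" where
  "prob_densities \<Omega> =
     {x \<in> L1 \<Omega>. (AE t in lebesgue_on \<Omega>. 0 \<le> x t) \<and> (LINT t|lebesgue_on \<Omega>. x t) = 1}"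

definition indicator_fun :: "'c set \<Rightarrow> 'c \<Rightarrow> ereal" where
  "indicator_fun S x = (if x \<in> S then 0 else \<infinity>)"

definition neg_entropy :: "'a::euclidean_space set \<Rightarrow> ('a \<Rightarrow> real) \<Rightarrow> ereal" where
  "neg_entropy \<Omega> x =
     (if x \<in> L1 \<Omega> \<and> (AE t in lebesgue_on \<Omega>. 0 \<le> x t) \<and> (\<lambda>t. x t * ln (x t)) \<in> L1 \<Omega>
      then ereal (LINT t|lebesgue_on \<Omega>. x t * ln (x t)) else \<infinity>)"

definition entropy_reg :: "'a::euclidean_space set \<Rightarrow> ('a \<Rightarrow> real) \<Rightarrow> ereal" where
  "entropy_reg \<Omega> x = neg_entropy \<Omega> x + indicator_fun (prob_densities \<Omega>) x"

definition primal_of_dual ::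
    "'a::euclidean_space set \<Rightarrow> (('a \<Rightarrow> real) \<Rightarrow> 'b::real_inner) \<Rightarrow> 'b \<Rightarrow> 'a \<Rightarrow> real" where
  "primal_of_dual \<Omega> A l t =
     1 / (LINT s|lebesgue_on \<Omega>. exp (L1_adjoint \<Omega> A l s)) * exp (L1_adjoint \<Omega> A l t)"

primrec dual_iter ::
    "'a::euclidean_space set \<Rightarrow> (('a \<Rightarrow> real) \<Rightarrow> 'b::real_inner) \<Rightarrow> real \<Rightarrow> 'b \<Rightarrow> nat \<Rightarrow> 'b" where
  "dual_iter \<Omega> A \<gamma> yd 0 = 0"
| "dual_iter \<Omega> A \<gamma> yd (Suc n) =
     dual_iter \<Omega> A \<gamma> yd n
       - \<gamma> *\<^sub>R (A (primal_of_dual \<Omega> A (dual_iter \<Omega> A \<gamma> yd n)) - yd)"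

definition primal_iter ::
    "'a::euclidean_space set \<Rightarrow> (('a \<Rightarrow> real) \<Rightarrow> 'b::real_inner) \<Rightarrow> real \<Rightarrow> 'b \<Rightarrow> nat \<Rightarrow> 'a \<Rightarrow> real"
  where "primal_iter \<Omega> A \<gamma> yd n = primal_of_dual \<Omega> A (dual_iter \<Omega> A \<gamma> yd n)"

text \<open>
  Since \<open>ln 0 = 0\<close> in HOL, positivity of \<open>x\<close> has to be required explicitly: the equation
  \<open>1 + log x = A\<^sup>* l\<close> with a finite right-hand side is false wherever \<open>x = 0\<close>.
\<close>

definition source_condition ::
    "'a::euclidean_space set \<Rightarrow> (('a \<Rightarrow> real) \<Rightarrow> 'b::real_inner) \<Rightarrow> ('a \<Rightarrow> real) \<Rightarrow> bool" where
  "source_condition \<Omega> A x \<longleftrightarrow>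
     (\<exists>l. AE t in lebesgue_on \<Omega>. 0 < x t \<and> 1 + ln (x t) = L1_adjoint \<Omega> A l t)"

definition discrepancy_index ::
    "'a::euclidean_space set \<Rightarrow> (('a \<Rightarrow> real) \<Rightarrow> 'b::real_inner) \<Rightarrow> real \<Rightarrow> real \<Rightarrow> real \<Rightarrow> 'b \<Rightarrow> nat
      \<Rightarrow> bool" where
  "discrepancy_index \<Omega> A \<gamma> \<tau> \<delta> yd N \<longleftrightarrow>
     norm (A (primal_iter \<Omega> A \<gamma> yd N) - yd) \<le> \<tau> * \<delta> \<and>
     (\<forall>n<N. \<tau> * \<delta> < norm (A (primal_iter \<Omega> A \<gamma> yd n) - yd))"

end

theory Submission
  imports Defs
begin

text \<open>
  Write \<open>X l\<close> for the density proportional to \<open>exp (A\<^sup>* l)\<close>, \<open>\<Phi> l = ln \<integral> exp (A\<^sup>* l)\<close> for the log-partition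
  function, and let \<open>gap l = R xdag - \<langle>l, y\<rangle> + \<Phi> l\<close>. For a density \<open>x\<close>, the number
  \<open>R x - \<langle>l, A x\<rangle> + \<Phi> l\<close> is the Kullback-Leibler divergence of \<open>x\<close> from \<open>X l\<close>. Taking \<open>x = xdag\<close>, it is
  the gap, so Pinsker's inequality gives \<open>\<parallel>X l - xdag\<parallel>\<^sup>2 \<le> 2 gap l\<close>, and everything reduces to bounding
  the gap along the iteration. Taking \<open>x = X l'\<close>, it is the Bregman distance of \<open>\<Phi>\<close>; Pinsker's
  inequality then makes \<open>\<Phi>\<close> convex with gradient \<open>l \<mapsto> A (X l)\<close> and smooth with constant \<open>\<parallel>A\<parallel>\<^sup>2\<close>. The
  iteration is thus gradient descent for the gap, in which the gradient \<open>A (X l) - y\<close> is perturbed by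
  the constant vector \<open>y - yd\<close> of norm at most \<open>\<delta>\<close>.

  For such a descent in an inner product space, the classical energy argument yields for every \<open>v\<close> and
  every \<open>n > 0\<close>
  \<open>gap l\<^sub>n \<le> gap v + \<parallel>v\<parallel>\<^sup>2 / (2 \<gamma> n) + \<gamma> n \<delta>\<^sup>2 / 2\<close> (lemma \<open>a_priori_estimate\<close>). Under the discrepancy
  principle each step before the stopping index \<open>N\<close> lowers the gap by at least \<open>2 \<gamma> \<delta>\<^sup>2\<close>. Comparing
  this decrease on the second half of the run with the estimate above at its midpoint shows
  that \<open>N \<delta>\<^sup>2\<close> is of the order of \<open>gap v + \<delta> \<parallel>v\<parallel> + \<delta>\<^sup>2\<close>, and convexity turns the small residual
  at \<open>N\<close> into a bound of the same kind for the gap (lemma \<open>discrepancy_estimate\<close>).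

  Since \<open>v\<close> is arbitrary, convergence follows once the infimum of the gap is zero, that is, once
  there is no duality gap (lemma \<open>gap_arbitrarily_small\<close>). Under the source condition the infimum is
  attained, and a point \<open>v\<close> with \<open>gap v = 0\<close> gives the bound \<open>O(\<delta>)\<close> for the gap and \<open>O(\<delta>\<^sup>1\<^sup>/\<^sup>2)\<close> for the
  error.

  The absence of a duality gap is shown without weak compactness: strong convexity of \<open>\<Phi>\<close> in the
  \<open>L\<^sup>1\<close> distance of the densities makes the densities of any minimizing sequence converge in
  \<open>L\<^sup>1\<close> norm. With a suitable minimizing sequence the limit is feasible, and Fatou's lemma bounds its
  entropy by \<open>R xdag - inf gap\<close>; minimality of \<open>xdag\<close> forces \<open>inf gap \<le> 0\<close>.
\<close>

section \<open>Pointwise form of Pinsker's inequality\<close>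

text \<open>
  The difference of the two sides and its derivative vanish at \<open>u = 1\<close>, and the second derivative is
  \<open>4 (ln u + 1 / u - 1) \<ge> 0\<close>.
\<close>

lemma pinsker_pointwise_one:
  fixes u :: real
  assumes "0 < u"
  shows "3 * (u - 1)\<^sup>2 \<le> (4 + 2 * u) * (u * ln u - u + 1)"
proof -
  define h where "h u = (4 + 2 * u) * (u * ln u - u + 1) - 3 * (u - 1)\<^sup>2" for u :: real
  define h' where "h' u = 4 * ((u + 1) * ln u - 2 * (u - 1))" for u :: real
  define h'' where "h'' u = 4 * (ln u + 1 / u - 1)" for u :: real
  have h: "(h has_real_derivative h' u) (at u)" if "u > 0" for u
    unfolding h_def[abs_def] h'_def using that
    by (auto intro!: derivative_eq_intros simp: field_simps power2_eq_square)
  have h': "(h' has_real_derivative h'' u) (at u)" if "u > 0" for u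
    unfolding h'_def[abs_def] h''_def using that
    by (auto intro!: derivative_eq_intros simp: field_simps)
  have h'': "h'' u \<ge> 0" if "u > 0" for u
    using ln_le_minus_one[of "1 / u"] that by (simp add: h''_def ln_div)
  have mono: "h' u \<le> h' v" if "0 < u" "u \<le> v" for u v
  proof (rule DERIV_nonneg_imp_nondecreasing[OF \<open>u \<le> v\<close>])
    fix x assume "u \<le> x"
    then show "\<exists>y. (h' has_real_derivative y) (at x) \<and> 0 \<le> y"
      using h'[of x] h''[of x] \<open>0 < u\<close> by (intro exI[of _ "h'' x"]) simp
  qed
  have at1: "h 1 = 0" "h' 1 = 0" by (simp_all add: h_def h'_def)
  have "0 \<le> h u"
  proof (cases "1 \<le> u")
    case True
    have "h 1 \<le> h u"
    proof (rule DERIV_nonneg_imp_nondecreasing[OF True])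
      fix x :: real assume "1 \<le> x"
      then show "\<exists>y. (h has_real_derivative y) (at x) \<and> 0 \<le> y"
        using h[of x] mono[of 1 x] at1 by (intro exI[of _ "h' x"]) simp
    qed
    then show ?thesis by (simp add: at1)
  next
    case False
    then have "u \<le> 1" by simp
    have "h 1 \<le> h u"
    proof (rule DERIV_nonpos_imp_nonincreasing[OF \<open>u \<le> 1\<close>])
      fix x :: real assume "u \<le> x" "x \<le> 1"
      then show "\<exists>y. (h has_real_derivative y) (at x) \<and> y \<le> 0"
        using h[of x] mono[of x 1] at1 assms by (intro exI[of _ "h' x"]) simp
    qed
    then show ?thesis by (simp add: at1)
  qed
  then show ?thesis by (simp add: h_def)
qed

lemma pinsker_pointwise:
  fixes p q :: real
  assumes p: "0 \<le> p" and q: "0 < q"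
  shows "3 * (p - q)\<^sup>2 \<le> (4 * q + 2 * p) * (p * ln p - p * ln q - p + q)"
proof (cases "p = 0")
  case True
  then show ?thesis using q by (simp add: power2_eq_square)
next
  case False
  then have "q\<^sup>2 * (3 * (p / q - 1)\<^sup>2)
      \<le> q\<^sup>2 * ((4 + 2 * (p / q)) * (p / q * ln (p / q) - p / q + 1))"
    using p q by (intro mult_left_mono pinsker_pointwise_one) auto
  moreover have "q\<^sup>2 * (3 * (p / q - 1)\<^sup>2) = 3 * (p - q)\<^sup>2"
    using q by (simp add: field_simps power2_eq_square)
  moreover have "q\<^sup>2 * ((4 + 2 * (p / q)) * (p / q * ln (p / q) - p / q + 1))
      = (4 * q + 2 * p) * (p * ln p - p * ln q - p + q)"
    using p q False by (simp add: field_simps power2_eq_square ln_div)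
  ultimately show ?thesis by simp
qed

text \<open>
  The arithmetic-geometric mean inequality applied to the previous bound. The first summand has
  integral \<open>t\<close> when \<open>p\<close> and \<open>q\<close> are densities, so integration gives \<open>\<parallel>p - q\<parallel> \<le> t + KL / (2 t)\<close>; the choice
  \<open>t = \<parallel>p - q\<parallel> / 2\<close> is Pinsker's inequality with the sharp constant.
\<close>

lemma pinsker_linear:
  fixes p q t :: real
  assumes p: "0 \<le> p" and q: "0 < q" and t: "0 < t"
  shows "\<bar>p - q\<bar> \<le> t * (4 * q + 2 * p) / 6 + (p * ln p - p * ln q - p + q) / (2 * t)"
proof -
  define w k where "w = t * (4 * q + 2 * p) / 6" and "k = (p * ln p - p * ln q - p + q) / (2 * t)"
  have w: "w > 0" using p q t by (simp add: w_def)
  have wk: "(p - q)\<^sup>2 \<le> 4 * (w * k)"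
    using pinsker_pointwise[OF p q] t by (simp add: w_def k_def)
  then have "0 \<le> w * k" by (smt (verit) zero_le_power2)
  then have k: "k \<ge> 0" using w by (simp add: zero_le_mult_iff)
  have "(p - q)\<^sup>2 \<le> (w + k)\<^sup>2"
    using wk zero_le_power2[of "w - k"] by (simp add: power2_eq_square algebra_simps)
  then have "\<bar>p - q\<bar> \<le> w + k"
    using w k by (metis abs_le_square_iff abs_of_nonneg add_nonneg_nonneg less_imp_le)
  then show ?thesis by (simp add: w_def k_def)
qed

section \<open>The dual of \<open>L\<^sup>1\<close> on a finite measure space\<close>

lemma finite_measure_bounded_domain:
  assumes "bounded_domain \<Omega>"
  shows "finite_measure (lebesgue_on \<Omega>)"
  using assms by (intro finite_measure_lebesgue_on) (auto simp: bounded_domain_def lmeasurable_open)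

text \<open>
  The set function \<open>S \<mapsto> \<phi> (indicator S)\<close> may be negative, but adding \<open>K\<close> times the underlying measure makes
  it nonnegative. The Radon-Nikodym theorem for positive measures then provides a density with values
  in \<open>[0, 2 K]\<close>, and subtracting \<open>K\<close> gives the representing function.
\<close>

lemma bounded_functional_L1_representation:
  fixes \<phi> :: "('a \<Rightarrow> real) \<Rightarrow> real"
  assumes M: "finite_measure M"
    and additive: "\<And>x y. integrable M x \<Longrightarrow> integrable M y \<Longrightarrow> \<phi> (\<lambda>t. x t + y t) = \<phi> x + \<phi> y"
    and scale: "\<And>c x. integrable M x \<Longrightarrow> \<phi> (\<lambda>t. c * x t) = c * \<phi> x"
    and bound: "\<And>x. integrable M x \<Longrightarrow> \<bar>\<phi> x\<bar> \<le> K * (LINT t|M. \<bar>x t\<bar>)"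
  obtains g where "g \<in> borel_measurable M" and "AE t in M. \<bar>g t\<bar> \<le> K"
    and "\<And>x. integrable M x \<Longrightarrow> (LINT t|M. g t * x t) = \<phi> x"
proof -
  interpret finite_measure M by (rule M)
  have diff: "\<phi> (\<lambda>t. x t - y t) = \<phi> x - \<phi> y" if "integrable M x" "integrable M y" for x y
    using additive[of x "\<lambda>t. (-1) * y t"] scale[of y "-1"] that by simp
  have zero: "\<phi> (\<lambda>t. 0) = 0" using scale[of "\<lambda>t. 0" 0] by simp
  have cont: "(\<lambda>i. \<phi> (s i)) \<longlonglongrightarrow> \<phi> x"
    if s: "\<And>i. integrable M (s i)" and x: "integrable M x"
      and lim: "(\<lambda>i. LINT t|M. \<bar>s i t - x t\<bar>) \<longlonglongrightarrow> 0" for s x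
  proof (rule LIM_zero_cancel, rule Lim_null_comparison)
    show "\<forall>\<^sub>F i in sequentially. norm (\<phi> (s i) - \<phi> x) \<le> K * (LINT t|M. \<bar>s i t - x t\<bar>)"
      using bound[of "\<lambda>t. s _ t - x t"] s x diff by auto
    show "(\<lambda>i. K * (LINT t|M. \<bar>s i t - x t\<bar>)) \<longlonglongrightarrow> 0"
      using tendsto_mult_right_zero[OF lim] .
  qed
  define F where "F S = K * measure M S + \<phi> (indicator S)" for S
  have ind: "integrable M (indicator S :: 'a \<Rightarrow> real)" if "S \<in> sets M" for S
    using that by (simp add: integrable_indicator_iff emeasure_finite less_top[symmetric])
  have indb: "\<bar>\<phi> (indicator S)\<bar> \<le> K * measure M S" if "S \<in> sets M" for S
    using bound[OF ind[OF that]] that by simp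
  have F_bounds: "0 \<le> F S" "F S \<le> 2 * K * measure M S" if "S \<in> sets M" for S
    using indb[OF that] by (auto simp: F_def)
  define N where "N = measure_of (space M) (sets M) (\<lambda>S. ennreal (F S))"
  have "(indicator {} :: 'a \<Rightarrow> real) = (\<lambda>t. 0)" by auto
  then have "F {} = 0" using zero by (simp add: F_def)
  have sumsF: "(\<lambda>i. F (S i)) sums F (\<Union>i. S i)"
    if S: "range S \<subseteq> sets M" "disjoint_family S" for S :: "nat \<Rightarrow> 'a set"
  proof -
    have Si: "S i \<in> sets M" for i using S by auto
    have part: "(\<Sum>i<n. \<phi> (indicator (S i))) = \<phi> (indicator (\<Union>i<n. S i))" for n
    proof (induction n)
      case 0
      then show ?case using zero by simp
    next
      case (Suc n)
      have disj: "S i \<inter> S n = {}" if "i < n" for i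
        using disjoint_family_onD[OF S(2), of i n] that by simp
      then have "(indicator (\<Union>i<Suc n. S i) :: 'a \<Rightarrow> real)
          = (\<lambda>t. indicator (\<Union>i<n. S i) t + indicator (S n) t)"
        by (intro ext) (use disj in \<open>auto simp: indicator_def lessThan_Suc less_Suc_eq\<close>)
      then show ?case using Suc Si by (simp add: additive ind)
    qed
    have "(\<lambda>n. \<phi> (indicator (\<Union>i<n. S i))) \<longlonglongrightarrow> \<phi> (indicator (\<Union>i. S i))"
    proof (rule cont)
      have "(\<lambda>n. measure M (\<Union>i. S i) - measure M (\<Union>i<n. S i)) \<longlonglongrightarrow> measure M (\<Union>i. S i) - measure M (\<Union>i. S i)"
      proof (intro tendsto_intros)
        have "(\<lambda>n. measure M (\<Union>i<n. S i)) \<longlonglongrightarrow> measure M (\<Union>n. \<Union>i<n. S i)"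
          using Si by (intro finite_Lim_measure_incseq) (auto simp: incseq_def intro: less_le_trans)
        then show "(\<lambda>n. measure M (\<Union>i<n. S i)) \<longlonglongrightarrow> measure M (\<Union>i. S i)"
          by (simp add: UN_UN_finite_eq lessThan_atLeast0)
      qed
      moreover have "(LINT t|M. \<bar>indicator (\<Union>i<n. S i) t - indicator (\<Union>i. S i) t :: real\<bar>)
          = measure M (\<Union>i. S i) - measure M (\<Union>i<n. S i)" for n
      proof -
        have "(LINT t|M. \<bar>indicator (\<Union>i<n. S i) t - indicator (\<Union>i. S i) t :: real\<bar>)
          = (LINT t|M. indicator (\<Union>i. S i) t - indicator (\<Union>i<n. S i) t)"
          by (intro Bochner_Integration.integral_cong) (auto split: split_indicator)
        also have "\<dots> = measure M (\<Union>i. S i) - measure M (\<Union>i<n. S i)"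
          using Si by (subst Bochner_Integration.integral_diff) (auto intro!: ind)
        finally show ?thesis .
      qed
      ultimately show "(\<lambda>n. LINT t|M. \<bar>indicator (\<Union>i<n. S i) t - indicator (\<Union>i. S i) t :: real\<bar>) \<longlonglongrightarrow> 0"
        by simp
    qed (use Si in \<open>auto intro!: ind\<close>)
    then have "(\<lambda>i. \<phi> (indicator (S i))) sums \<phi> (indicator (\<Union>i. S i))"
      by (simp add: sums_def part)
    moreover have "(\<lambda>i. measure M (S i)) sums measure M (\<Union>i. S i)"
      using finite_measure_UNION S by blast
    ultimately show ?thesis unfolding F_def by (intro sums_add sums_mult)
  qed
  have emeasure_N: "emeasure N S = ennreal (F S)" if "S \<in> sets M" for S
    unfolding N_def
  proof (rule emeasure_measure_of_sigma[OF sets.sigma_algebra_axioms _ _ that])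
    show "positive (sets M) (\<lambda>S. ennreal (F S))" by (simp add: positive_def \<open>F {} = 0\<close>)
    show "countably_additive (sets M) (\<lambda>S. ennreal (F S))"
    proof (rule countably_additiveI)
      fix S :: "nat \<Rightarrow> 'a set"
      assume S: "range S \<subseteq> sets M" "disjoint_family S"
      then have "F (S i) \<ge> 0" for i using F_bounds by auto
      then show "(\<Sum>i. ennreal (F (S i))) = ennreal (F (\<Union> (range S)))"
        using sumsF[OF S] by (simp add: suminf_ennreal2 sums_iff)
    qed
  qed
  have sets_N: "sets N = sets M" by (simp add: N_def)
  have "absolutely_continuous M N"
    unfolding absolutely_continuous_def
  proof
    fix S assume "S \<in> null_sets M"
    then have "S \<in> sets M" "measure M S = 0" by (auto simp: measure_eq_0_null_sets)
    then have "emeasure N S = 0" using F_bounds[of S] by (simp add: emeasure_N)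
    then show "S \<in> null_sets N" using \<open>S \<in> sets M\<close> by (simp add: null_sets_def sets_N)
  qed
  from Radon_Nikodym[OF this sets_N]
  obtain f where f: "f \<in> borel_measurable M" "density M f = N" by blast
  have fS: "(\<integral>\<^sup>+t. f t * indicator S t \<partial>M) = ennreal (F S)" if "S \<in> sets M" for S
    using emeasure_N[OF that] emeasure_density[OF f(1) that] by (simp add: f(2))
  have K0: "0 \<le> K" if "measure M (space M) \<noteq> 0"
    using indb[of "space M"] that by (smt (verit) measure_nonneg mult_neg_pos sets.top zero_less_measure_iff)
  have fK: "AE t in M. f t \<le> ennreal (2 * K)"
  proof -
    define B where "B = {t \<in> space M. ennreal (2 * K) < f t}"
    have B: "B \<in> sets M" using f by (auto simp: B_def)
    have "B \<in> null_sets M"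
    proof (rule ccontr)
      assume nB: "B \<notin> null_sets M"
      have "(\<integral>\<^sup>+t. ennreal (2 * K) * indicator B t \<partial>M) < (\<integral>\<^sup>+t. f t * indicator B t \<partial>M)"
      proof (rule nn_integral_less)
        show "(\<integral>\<^sup>+t. ennreal (2 * K) * indicator B t \<partial>M) \<noteq> \<infinity>"
          using B by (simp add: nn_integral_cmult_indicator ennreal_mult_eq_top_iff emeasure_finite)
        show "AE t in M. ennreal (2 * K) * indicator B t \<le> f t * indicator B t"
          by (auto simp: B_def split: split_indicator)
        show "\<not> (AE t in M. f t * indicator B t \<le> ennreal (2 * K) * indicator B t)"
        proof
          assume "AE t in M. f t * indicator B t \<le> ennreal (2 * K) * indicator B t"
          then have "AE t in M. t \<notin> B"
            by eventually_elim (auto simp: B_def split: split_indicator_asm)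
          then show False using nB B AE_iff_null_sets by blast
        qed
      qed (use f B in auto)
      also have "\<dots> \<le> ennreal (2 * K * measure M B)"
        using fS[OF B] F_bounds[OF B] by (simp add: ennreal_leI)
      also have "\<dots> = (\<integral>\<^sup>+t. ennreal (2 * K) * indicator B t \<partial>M)"
        using B by (cases "2 * K \<ge> 0") (simp_all add: nn_integral_cmult_indicator emeasure_eq_measure ennreal_mult' ennreal_neg mult_nonpos_nonneg)
      finally show False by simp
    qed
    then have "AE t in M. t \<notin> B" using AE_not_in by blast
    with AE_space show ?thesis by eventually_elim (auto simp: B_def)
  qed
  define g where "g t = enn2real (f t) - K" for t
  have g_meas: "g \<in> borel_measurable M" unfolding g_def[abs_def] using f by measurable
  have g_bound: "AE t in M. \<bar>g t\<bar> \<le> K"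
  proof (cases "measure M (space M) = 0")
    case True
    then have "space M \<in> null_sets M" by (auto simp: null_sets_def emeasure_eq_measure)
    then show ?thesis by (metis (no_types, lifting) AE_I' mem_Collect_eq subsetI)
  next
    case False
    show ?thesis using fK
    proof eventually_elim
      case (elim t)
      have "enn2real (f t) \<le> 2 * K" using enn2real_mono[OF elim] K0[OF False] by simp
      then show ?case using enn2real_nonneg[of "f t"] by (simp add: g_def abs_le_iff)
    qed
  qed
  have gx: "integrable M (\<lambda>t. g t * x t)" if "integrable M x" for x
  proof (rule Bochner_Integration.integrable_bound)
    show "integrable M (\<lambda>t. K * x t)" using that by simp
    show "AE t in M. norm (g t * x t) \<le> norm (K * x t)"
      using g_bound by eventually_elim (simp add: abs_mult mult_right_mono)
  qed (use that g_meas in measurable)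
  have rep: "(LINT t|M. g t * x t) = \<phi> x" if "integrable M x" for x
    using that
  proof (induct rule: integrable_induct)
    case (base S c)
    have fi: "(LINT t|M. enn2real (f t) * indicator S t) = F S"
    proof (rule integral_eq_nn_integral[THEN trans])
      have "(\<integral>\<^sup>+t. ennreal (enn2real (f t) * indicator S t) \<partial>M) = (\<integral>\<^sup>+t. f t * indicator S t \<partial>M)"
        using fK by (intro nn_integral_cong_AE, eventually_elim)
          (auto split: split_indicator intro!: ennreal_enn2real intro: order.strict_trans1[OF _ ennreal_less_top])
      then show "enn2real (\<integral>\<^sup>+t. ennreal (enn2real (f t) * indicator S t) \<partial>M) = F S"
        using fS[OF base(1)] F_bounds[OF base(1)] by simp
    qed (use f base in auto)
    have "(LINT t|M. g t * indicator S t) = (LINT t|M. (g t * indicator S t + K * indicator S t) - K * indicator S t)"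
      by simp
    also have "\<dots> = (LINT t|M. g t * indicator S t + K * indicator S t) - (LINT t|M. K * indicator S t)"
      using gx[OF ind[OF base(1)]] ind[OF base(1)] by (intro Bochner_Integration.integral_diff) auto
    also have "(LINT t|M. g t * indicator S t + K * indicator S t) = F S"
      using fi by (simp add: g_def algebra_simps)
    finally have "(LINT t|M. g t * indicator S t) = \<phi> (indicator S)"
      using base by (simp add: F_def)
    then show ?case
      using scale[OF ind[OF base(1)], of c] by (simp add: mult.commute mult.left_commute)
  next
    case (add x y)
    then show ?case using gx additive[of x y] by (simp add: distrib_left)
  next
    case (lim x s)
    have bd: "AE t in M. norm (s i t - x t) \<le> 3 * norm (x t)" for i
    proof (rule AE_I2)
      fix t assume "t \<in> space M"
      then show "norm (s i t - x t) \<le> 3 * norm (x t)"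
        using lim(4)[of t i] norm_triangle_ineq4[of "s i t" "x t"] by simp
    qed
    have "(\<lambda>i. LINT t|M. norm (s i t - x t)) \<longlonglongrightarrow> (LINT t|M. 0)"
    proof (rule integral_dominated_convergence[where w="\<lambda>t. 3 * norm (x t)"])
      show "AE t in M. (\<lambda>i. norm (s i t - x t)) \<longlonglongrightarrow> 0"
        using tendsto_norm_zero[OF LIM_zero[OF lim(3)]] by (intro AE_I2) simp
    qed (use lim bd in auto)
    then have L1: "(\<lambda>i. LINT t|M. \<bar>s i t - x t\<bar>) \<longlonglongrightarrow> 0" by simp
    have "(\<lambda>i. LINT t|M. g t * s i t) \<longlonglongrightarrow> (LINT t|M. g t * x t)"
    proof (rule LIM_zero_cancel, rule Lim_null_comparison)
      show "(\<lambda>i. K * (LINT t|M. \<bar>s i t - x t\<bar>)) \<longlonglongrightarrow> 0"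
        using tendsto_mult_right_zero[OF L1] .
      have "norm ((LINT t|M. g t * s i t) - (LINT t|M. g t * x t)) \<le> K * (LINT t|M. \<bar>s i t - x t\<bar>)" for i
      proof -
        have "norm ((LINT t|M. g t * s i t) - (LINT t|M. g t * x t)) = norm (LINT t|M. g t * (s i t - x t))"
          using gx[OF lim(1)[of i]] gx[OF lim(5)] by (simp add: right_diff_distrib)
        also have "\<dots> \<le> (LINT t|M. norm (g t * (s i t - x t)))"
          by (rule integral_norm_bound)
        also have "\<dots> \<le> (LINT t|M. K * \<bar>s i t - x t\<bar>)"
        proof (rule integral_mono_AE)
          show "integrable M (\<lambda>t. norm (g t * (s i t - x t)))" using gx lim by simp
          show "integrable M (\<lambda>t. K * \<bar>s i t - x t\<bar>)" using lim by simp
          show "AE t in M. norm (g t * (s i t - x t)) \<le> K * \<bar>s i t - x t\<bar>"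
            using g_bound by eventually_elim (simp add: abs_mult mult_right_mono)
        qed
        finally show ?thesis by simp
      qed
      then show "\<forall>\<^sub>F i in sequentially. norm ((LINT t|M. g t * s i t) - (LINT t|M. g t * x t))
          \<le> K * (LINT t|M. \<bar>s i t - x t\<bar>)" by simp
    qed
    moreover have "(\<lambda>i. LINT t|M. g t * s i t) \<longlonglongrightarrow> \<phi> x"
      using cont[OF lim(1) lim(5) L1] lim(2) by simp
    ultimately show ?case by (rule LIMSEQ_unique)
  qed
  show thesis by (rule that[OF g_meas g_bound rep])
qed

section \<open>Exponential densities and the log-partition function\<close>

locale entropic_operator =
  fixes \<Omega> :: "'a::euclidean_space set"
    and A :: "('a \<Rightarrow> real) \<Rightarrow> 'b::real_inner"
  assumes domain: "bounded_domain \<Omega>" and A: "bounded_linear_L1 \<Omega> A"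
begin

abbreviation M :: "'a measure" where "M \<equiv> lebesgue_on \<Omega>"
abbreviation adj :: "'b \<Rightarrow> 'a \<Rightarrow> real" where "adj \<equiv> L1_adjoint \<Omega> A"
abbreviation X :: "'b \<Rightarrow> 'a \<Rightarrow> real" where "X \<equiv> primal_of_dual \<Omega> A"
abbreviation opnorm :: real where "opnorm \<equiv> L1_onorm \<Omega> A"

definition partition :: "'b \<Rightarrow> real" where "partition l = (LINT t|M. exp (adj l t))"

definition log_partition :: "'b \<Rightarrow> real" where "log_partition l = ln (partition l)"

sublocale finite_measure M
  by (rule finite_measure_bounded_domain[OF domain])

lemma measure_pos: "0 < measure M (space M)"
proof -
  have "emeasure lebesgue \<Omega> \<noteq> 0"
    using domain open_not_negligible[of \<Omega>]
    by (auto simp: bounded_domain_def negligible_iff_emeasure0)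
  then have "emeasure M (space M) \<noteq> 0"
    using domain by (simp add: emeasure_restrict_space bounded_domain_def lmeasurable_open fmeasurableD)
  then show ?thesis
    by (simp add: emeasure_eq_measure zero_less_measure_iff)
qed

lemma L1_norm_nonneg: "0 \<le> L1_norm \<Omega> x"
  by (simp add: L1_norm_def)

lemma A_add: "x \<in> L1 \<Omega> \<Longrightarrow> x' \<in> L1 \<Omega> \<Longrightarrow> A (\<lambda>t. x t + x' t) = A x + A x'"
  and A_scale: "x \<in> L1 \<Omega> \<Longrightarrow> A (\<lambda>t. c * x t) = c *\<^sub>R A x"
  using A by (auto simp: bounded_linear_L1_def)

lemma A_diff: "x \<in> L1 \<Omega> \<Longrightarrow> x' \<in> L1 \<Omega> \<Longrightarrow> A (\<lambda>t. x t - x' t) = A x - A x'"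
  using A_add[of x "\<lambda>t. (-1) * x' t"] A_scale[of x' "-1"] by (simp add: L1_def)

lemma norm_A_le:
  assumes "x \<in> L1 \<Omega>"
  shows "norm (A x) \<le> opnorm * L1_norm \<Omega> x"
proof -
  obtain K where K: "\<And>x. x \<in> L1 \<Omega> \<Longrightarrow> norm (A x) \<le> K * L1_norm \<Omega> x"
    using A unfolding bounded_linear_L1_def by blast
  have "bdd_above ((\<lambda>x. norm (A x) / L1_norm \<Omega> x) ` L1 \<Omega>)"
  proof (rule bdd_aboveI2)
    fix x assume "x \<in> L1 \<Omega>"
    then show "norm (A x) / L1_norm \<Omega> x \<le> \<bar>K\<bar>"
      using K[of x] L1_norm_nonneg[of x] order_trans[OF K mult_right_mono[OF abs_ge_self[of K]]]
      by (cases "L1_norm \<Omega> x = 0") (auto simp: field_simps)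
  qed
  then have "norm (A x) / L1_norm \<Omega> x \<le> opnorm"
    unfolding L1_onorm_def using assms by (rule cSUP_upper2) simp
  then show ?thesis
    using K[OF assms] L1_norm_nonneg[of x] by (cases "L1_norm \<Omega> x = 0") (auto simp: field_simps)
qed

lemma opnorm_nonneg: "0 \<le> opnorm"
proof -
  have "(\<lambda>t. 1) \<in> L1 \<Omega>" "L1_norm \<Omega> (\<lambda>t. 1) > 0"
    using measure_pos by (simp_all add: L1_def L1_norm_def)
  then show ?thesis
    using norm_A_le[of "\<lambda>t. 1"] by (smt (verit) mult_neg_pos norm_ge_zero)
qed

lemma
  shows adj_Linfty: "adj l \<in> Linfty \<Omega>"
    and adj_eq: "x \<in> L1 \<Omega> \<Longrightarrow> (LINT t|M. adj l t * x t) = inner l (A x)"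
proof -
  have "\<bar>inner l (A x)\<bar> \<le> norm l * opnorm * (LINT t|M. \<bar>x t\<bar>)" if "integrable M x" for x
    using Cauchy_Schwarz_ineq2[of l "A x"] mult_left_mono[OF norm_A_le[of x] norm_ge_zero[of l]] that
    by (simp add: L1_def L1_norm_def mult.assoc)
  then obtain g where "g \<in> borel_measurable M" "AE t in M. \<bar>g t\<bar> \<le> norm l * opnorm"
    and "\<And>x. integrable M x \<Longrightarrow> (LINT t|M. g t * x t) = inner l (A x)"
    using bounded_functional_L1_representation[OF finite_measure_axioms, of "\<lambda>x. inner l (A x)" "norm l * opnorm"]
    by (auto simp: A_add A_scale L1_def inner_add_right)
  then have "\<exists>g. g \<in> Linfty \<Omega> \<and> (\<forall>x\<in>L1 \<Omega>. (LINT t|M. g t * x t) = inner l (A x))"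
    by (auto simp: L1_def Linfty_def)
  from someI_ex[OF this] show "adj l \<in> Linfty \<Omega>"
    "x \<in> L1 \<Omega> \<Longrightarrow> (LINT t|M. adj l t * x t) = inner l (A x)"
    unfolding L1_adjoint_def by auto
qed

lemma adj_measurable [measurable]: "adj l \<in> borel_measurable M"
  using adj_Linfty[of l] by (simp add: Linfty_def)

lemma adj_bounded: obtains C where "AE t in M. \<bar>adj l t\<bar> \<le> C"
  using adj_Linfty[of l] by (auto simp: Linfty_def)

lemma integrable_adj_mult:
  assumes "x \<in> L1 \<Omega>"
  shows "integrable M (\<lambda>t. adj l t * x t)"
proof -
  obtain C where C: "AE t in M. \<bar>adj l t\<bar> \<le> C" by (rule adj_bounded)
  show ?thesis
  proof (rule Bochner_Integration.integrable_bound)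
    show "integrable M (\<lambda>t. C * x t)" using assms by (simp add: L1_def)
    show "AE t in M. norm (adj l t * x t) \<le> norm (C * x t)"
      using C by eventually_elim (simp add: abs_mult mult_right_mono)
  qed (use assms in \<open>simp add: L1_def\<close>)
qed

lemma integrable_exp_adj: "integrable M (\<lambda>t. exp (adj l t))"
proof -
  obtain C where C: "AE t in M. \<bar>adj l t\<bar> \<le> C" by (rule adj_bounded)
  show ?thesis
    by (rule integrable_const_bound[of _ "exp C"]) (use C in auto)
qed

lemma partition_pos: "0 < partition l"
proof -
  obtain C where C: "AE t in M. \<bar>adj l t\<bar> \<le> C" by (rule adj_bounded)
  have "0 < exp (- C) * measure M (space M)" using measure_pos by simp
  also have "\<dots> = (LINT t|M. exp (- C))" by simp
  also have "\<dots> \<le> partition l" unfolding partition_def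
    by (intro integral_mono_AE integrable_exp_adj) (use C in auto)
  finally show ?thesis .
qed

lemma X_eq: "X l t = exp (adj l t - log_partition l)"
  using partition_pos[of l] by (simp add: primal_of_dual_def partition_def log_partition_def exp_diff)

lemma X_pos: "0 < X l t"
  by (simp add: X_eq)

lemma ln_X: "ln (X l t) = adj l t - log_partition l"
  by (simp add: X_eq)

lemma X_L1: "X l \<in> L1 \<Omega>"
  using integrable_exp_adj[of l] by (simp add: L1_def primal_of_dual_def[abs_def])

lemma X_integral: "(LINT t|M. X l t) = 1"
  using partition_pos[of l] by (simp add: primal_of_dual_def partition_def)

lemma X_prob: "X l \<in> prob_densities \<Omega>"
  using X_L1 X_integral X_pos by (simp add: prob_densities_def less_imp_le)

lemma L1_norm_X: "L1_norm \<Omega> (X l) = 1"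
  using X_integral by (simp add: L1_norm_def X_pos abs_of_pos)

definition entropy :: "('a \<Rightarrow> real) \<Rightarrow> real" where "entropy x = (LINT t|M. x t * ln (x t))"

definition finite_entropy :: "('a \<Rightarrow> real) \<Rightarrow> bool" where
  "finite_entropy x \<longleftrightarrow> x \<in> prob_densities \<Omega> \<and> (\<lambda>t. x t * ln (x t)) \<in> L1 \<Omega>"

lemma entropy_reg_eq: "entropy_reg \<Omega> x = (if finite_entropy x then ereal (entropy x) else \<infinity>)"
  by (auto simp: entropy_reg_def neg_entropy_def indicator_fun_def finite_entropy_def entropy_def prob_densities_def)

lemma X_ln_X: "X l t * ln (X l t) = adj l t * X l t - log_partition l * X l t"
  by (simp add: ln_X algebra_simps)

lemma X_finite_entropy: "finite_entropy (X l)"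
  and entropy_X: "entropy (X l) = inner l (A (X l)) - log_partition l"
proof -
  have i: "integrable M (\<lambda>t. adj l t * X l t)" "integrable M (\<lambda>t. log_partition l * X l t)"
    using integrable_adj_mult[OF X_L1] X_L1[of l] by (simp_all add: L1_def)
  then show "finite_entropy (X l)"
    unfolding finite_entropy_def using X_prob by (simp add: L1_def X_ln_X)
  show "entropy (X l) = inner l (A (X l)) - log_partition l"
    unfolding entropy_def X_ln_X using i by (simp add: adj_eq X_L1 X_integral)
qed

text \<open>
  The right-hand side is the Kullback-Leibler divergence of \<open>x\<close> from \<open>X l\<close>, because
  \<open>ln (X l) = A\<^sup>* l - log_partition l\<close> and \<open>\<integral> (A\<^sup>* l) x = \<langle>l, A x\<rangle>\<close>.
\<close>

lemma pinsker:
  assumes x: "finite_entropy x"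
  shows "(L1_norm \<Omega> (\<lambda>t. x t - X l t))\<^sup>2 / 2 \<le> entropy x - inner l (A x) + log_partition l"
proof -
  define N where "N = L1_norm \<Omega> (\<lambda>t. x t - X l t)"
  define KL where "KL = entropy x - inner l (A x) + log_partition l"
  define k where "k t = x t * ln (x t) - x t * ln (X l t) - x t + X l t" for t
  have x1: "integrable M x" "AE t in M. 0 \<le> x t" "(LINT t|M. x t) = 1"
    and xl: "integrable M (\<lambda>t. x t * ln (x t))"
    using x by (auto simp: finite_entropy_def prob_densities_def L1_def)
  have X1: "integrable M (X l)" using X_L1[of l] by (simp add: L1_def)
  have xa: "integrable M (\<lambda>t. adj l t * x t)" using integrable_adj_mult x1(1) by (simp add: L1_def)
  have k_eq: "k = (\<lambda>t. x t * ln (x t) - (adj l t * x t - log_partition l * x t) - x t + X l t)"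
    by (simp add: fun_eq_iff k_def ln_X algebra_simps)
  have k_int: "integrable M k" "(LINT t|M. k t) = KL"
    unfolding k_eq KL_def using x1 xl X1 xa
    by (simp_all add: entropy_def adj_eq L1_def X_integral)
  have lin: "N \<le> t + KL / (2 * t)" if t: "0 < t" for t
  proof -
    have "N = (LINT s|M. \<bar>x s - X l s\<bar>)" by (simp add: N_def L1_norm_def)
    also have "\<dots> \<le> (LINT s|M. t * (4 * X l s + 2 * x s) / 6 + k s / (2 * t))"
    proof (rule integral_mono_AE)
      show "AE s in M. \<bar>x s - X l s\<bar> \<le> t * (4 * X l s + 2 * x s) / 6 + k s / (2 * t)"
        using x1(2) by eventually_elim (simp add: k_def pinsker_linear X_pos t)
    qed (use x1 X1 k_int in auto)
    also have "\<dots> = t + KL / (2 * t)"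
      using x1 X1 k_int by (simp add: X_integral)
    finally show ?thesis .
  qed
  have "N\<^sup>2 / 2 \<le> KL"
  proof (cases "N = 0")
    case True
    have "0 \<le> (LINT t|M. k t)"
    proof (rule integral_nonneg_AE)
      show "AE s in M. 0 \<le> k s" using x1(2)
      proof eventually_elim
        case (elim s)
        have "0 \<le> (4 * X l s + 2 * x s) * k s"
          using pinsker_pointwise[OF elim X_pos[of l s]] zero_le_power2[of "x s - X l s"]
          unfolding k_def by linarith
        then show ?case using elim X_pos[of l s] by (simp add: zero_le_mult_iff)
      qed
    qed
    then show ?thesis using True k_int by simp
  next
    case False
    then have "N > 0" using L1_norm_nonneg[of "\<lambda>t. x t - X l t"] by (simp add: N_def)
    then show ?thesis using lin[of "N / 2"] by (simp add: field_simps power2_eq_square)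
  qed
  then show ?thesis by (simp add: N_def KL_def)
qed

text \<open>
  Pinsker's inequality for two exponential densities: the divergence of \<open>X l\<close> from \<open>X u\<close> is the Bregman
  distance of the log-partition function.
\<close>

lemma log_partition_strong_convex:
  "log_partition l + inner (u - l) (A (X l)) + (L1_norm \<Omega> (\<lambda>t. X l t - X u t))\<^sup>2 / 2 \<le> log_partition u"
  using pinsker[OF X_finite_entropy[of l], of u] by (simp add: entropy_X inner_diff_left)

lemma log_partition_convex: "log_partition l + inner (u - l) (A (X l)) \<le> log_partition u"
  using log_partition_strong_convex[of l u] zero_le_power2[of "L1_norm \<Omega> (\<lambda>t. X l t - X u t)"]
  by linarith

text \<open>
  The two Bregman distances between \<open>l\<close> and \<open>u\<close> add up to
  \<open>\<langle>u - l, A (X u - X l)\<rangle> \<le> C s\<close>, where \<open>C = \<parallel>A\<parallel> \<parallel>u - l\<parallel>\<close> and \<open>s\<close> is the \<open>L\<^sup>1\<close> distance of the densities.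
  One of them is at least \<open>s\<^sup>2 / 2\<close>, so the other is at most \<open>C s - s\<^sup>2 / 2 \<le> C\<^sup>2 / 2\<close>.
\<close>

lemma log_partition_smooth:
  "log_partition u \<le> log_partition l + inner (u - l) (A (X l)) + opnorm\<^sup>2 / 2 * (norm (u - l))\<^sup>2"
proof -
  define s where "s = L1_norm \<Omega> (\<lambda>t. X u t - X l t)"
  have "inner (u - l) (A (X u) - A (X l)) \<le> norm (u - l) * (opnorm * s)"
    unfolding s_def A_diff[OF X_L1 X_L1, symmetric]
    using X_L1 by (intro order_trans[OF norm_cauchy_schwarz] mult_left_mono norm_A_le) (auto simp: L1_def)
  moreover have "log_partition u + inner (l - u) (A (X u)) + s\<^sup>2 / 2 \<le> log_partition l"
    unfolding s_def by (rule log_partition_strong_convex)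
  moreover have "2 * (opnorm * norm (u - l)) * s \<le> (opnorm * norm (u - l))\<^sup>2 + s\<^sup>2"
    by (rule sum_squares_bound)
  ultimately show ?thesis
    by (simp add: inner_diff_left inner_diff_right power_mult_distrib algebra_simps)
qed

text \<open>
  Under the source condition \<open>x = exp (A\<^sup>* l - 1)\<close>. Having integral 1, it is the exponential density
  \<open>X l\<close>, with log-partition value 1, so its divergence from \<open>X l\<close> vanishes.
\<close>

lemma source_condition_imp_dual_attained:
  assumes "finite_entropy x" and "source_condition \<Omega> A x"
  obtains l where "entropy x = inner l (A x) - log_partition l"
proof -
  from assms(2) obtain l where l: "AE t in M. 0 < x t \<and> 1 + ln (x t) = adj l t"
    by (auto simp: source_condition_def)
  have x: "integrable M x" "(LINT t|M. x t) = 1"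
    using assms(1) by (auto simp: finite_entropy_def prob_densities_def L1_def)
  have "partition l = (LINT t|M. exp 1 * x t)" unfolding partition_def
  proof (rule integral_cong_AE)
    show "AE t in M. exp (adj l t) = exp 1 * x t"
      using l by eventually_elim (metis exp_add exp_ln)
  qed (use x in auto)
  then have "log_partition l = 1" using x by (simp add: log_partition_def)
  have "entropy x = (LINT t|M. adj l t * x t - x t)" unfolding entropy_def
  proof (rule integral_cong_AE)
    show "AE t in M. x t * ln (x t) = adj l t * x t - x t"
      using l by eventually_elim (metis add_diff_cancel_left' left_diff_distrib mult.commute mult_1)
  qed (use x in auto)
  also have "\<dots> = inner l (A x) - 1"
    using x integrable_adj_mult[of x l] by (simp add: L1_def adj_eq)
  finally show thesis using that[of l] \<open>log_partition l = 1\<close> by simp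
qed

end

section \<open>Completeness of \<open>L\<^sup>1\<close> and lower semicontinuity of the entropy\<close>

text \<open>
  The increments sum up absolutely almost everywhere, because their norms have a finite integral by
  monotone convergence; that sum \<open>W\<close> also dominates the partial sums.
\<close>

lemma L1_limit_of_fast_Cauchy_sequence:
  fixes x :: "nat \<Rightarrow> 'a \<Rightarrow> real"
  assumes x: "\<And>n. integrable M (x n)"
    and fast: "\<And>n. (LINT t|M. \<bar>x (Suc n) t - x n t\<bar>) \<le> (1 / 2) ^ n"
  obtains z where "integrable M z" and "AE t in M. (\<lambda>n. x n t) \<longlonglongrightarrow> z t"
    and "(\<lambda>n. LINT t|M. \<bar>x n t - z t\<bar>) \<longlonglongrightarrow> 0"
proof -
  define f where "f n t = x (Suc n) t - x n t" for n t
  have f: "integrable M (f n)" for n using x by (simp add: f_def[abs_def])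
  have sum: "summable (\<lambda>n. LINT t|M. norm (f n t))"
    by (rule summable_comparison_test'[of "\<lambda>n. (1 / 2 :: real) ^ n" 0]) (use fast in \<open>auto simp: f_def\<close>)
  have "(\<integral>\<^sup>+t. (\<Sum>n. ennreal (norm (f n t))) \<partial>M) = (\<Sum>n. \<integral>\<^sup>+t. ennreal (norm (f n t)) \<partial>M)"
    using f by (intro nn_integral_suminf) auto
  also have "\<dots> = (\<Sum>n. ennreal (LINT t|M. norm (f n t)))"
    using f by (intro suminf_cong nn_integral_eq_integral) auto
  also have "\<dots> \<noteq> \<infinity>"
    using sum by (simp add: ennreal_suminf_neq_top)
  finally have "AE t in M. (\<Sum>n. ennreal (norm (f n t))) \<noteq> \<infinity>"
    using f by (intro nn_integral_PInf_AE) auto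
  then have AEsum: "AE t in M. summable (\<lambda>n. norm (f n t))"
    by eventually_elim (auto intro: summable_suminf_not_top)
  define W where "W t = (\<Sum>n. norm (f n t))" for t
  define z where "z t = x 0 t + (\<Sum>n. f n t)" for t
  have W: "integrable M W" unfolding W_def[abs_def]
    by (rule integrable_suminf) (use f AEsum sum in auto)
  have z: "integrable M z" unfolding z_def[abs_def]
    using integrable_suminf[OF f AEsum sum] x by simp
  have x_sum: "x n t = x 0 t + (\<Sum>i<n. f i t)" for n t
    by (induction n) (simp_all add: f_def)
  have lim: "AE t in M. (\<lambda>n. x n t) \<longlonglongrightarrow> z t"
    using AEsum
  proof eventually_elim
    case (elim t)
    have "(\<lambda>n. \<Sum>i<n. f i t) \<longlonglongrightarrow> (\<Sum>i. f i t)"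
      using summable_norm_cancel[OF elim] by (rule summable_LIMSEQ)
    then have "(\<lambda>n. x 0 t + (\<Sum>i<n. f i t)) \<longlonglongrightarrow> z t"
      unfolding z_def by (intro tendsto_intros)
    then show ?case by (simp only: x_sum[symmetric])
  qed
  have bound: "AE t in M. norm \<bar>x n t - z t\<bar> \<le> 2 * W t" for n
    using AEsum
  proof eventually_elim
    case (elim t)
    have "\<bar>\<Sum>i<n. f i t\<bar> \<le> (\<Sum>i<n. norm (f i t))" by (simp add: sum_abs)
    also have "\<dots> \<le> W t" unfolding W_def by (rule sum_le_suminf[OF elim]) auto
    finally have "\<bar>\<Sum>i<n. f i t\<bar> \<le> W t" .
    moreover have "\<bar>\<Sum>i. f i t\<bar> \<le> W t" unfolding W_def using summable_norm[OF elim] by simp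
    ultimately show ?case unfolding x_sum[of n t] z_def by simp
  qed
  have "(\<lambda>n. LINT t|M. \<bar>x n t - z t\<bar>) \<longlonglongrightarrow> (LINT t|M. 0)"
  proof (rule integral_dominated_convergence[where w="\<lambda>t. 2 * W t"])
    show "AE t in M. (\<lambda>n. \<bar>x n t - z t\<bar>) \<longlonglongrightarrow> 0"
      using lim by eventually_elim (simp add: LIM_zero tendsto_rabs_zero)
  qed (use x z W bound in auto)
  then show thesis using that[OF z lim] by simp
qed

lemma mult_ln_lower: "-1 \<le> x * ln x" if "0 \<le> x" for x :: real
proof (cases "x = 0")
  case False
  then have "x * (1 - 1 / x) \<le> x * ln x"
    using that ln_le_minus_one[of "1 / x"] by (intro mult_left_mono) (auto simp: ln_div)
  then show ?thesis using that False by (simp add: algebra_simps)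
qed simp

lemma tendsto_mult_ln:
  fixes x :: "'i \<Rightarrow> real"
  assumes lim: "(x \<longlongrightarrow> a) F" and pos: "\<And>i. 0 < x i" and "0 \<le> a"
  shows "((\<lambda>i. x i * ln (x i)) \<longlongrightarrow> a * ln a) F"
proof (cases "a = 0")
  case False
  then show ?thesis by (intro tendsto_intros lim)
next
  case True
  have bound: "norm (x i * ln (x i)) \<le> 2 * sqrt (x i)" if "x i < 1" for i
  proof -
    have "ln (1 / sqrt (x i)) \<le> 1 / sqrt (x i)"
      using ln_le_minus_one[of "1 / sqrt (x i)"] pos[of i] by simp
    then have "- ln (x i) \<le> 2 / sqrt (x i)"
      using pos[of i] by (simp add: ln_div ln_sqrt)
    then have "x i * (- ln (x i)) \<le> x i * (2 / sqrt (x i))"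
      using pos[of i] by (intro mult_left_mono) auto
    also have "\<dots> = 2 * sqrt (x i)"
      using pos[of i] by (simp add: field_simps)
    finally show ?thesis using pos[of i] that by (simp add: abs_mult)
  qed
  have "((\<lambda>i. 2 * sqrt (x i)) \<longlongrightarrow> 2 * sqrt 0) F"
    using lim True by (intro tendsto_intros) simp
  then have "((\<lambda>i. x i * ln (x i)) \<longlongrightarrow> 0) F"
  proof (rule Lim_null_comparison[rotated, OF tendsto_eq_rhs])
    show "\<forall>\<^sub>F i in F. norm (x i * ln (x i)) \<le> 2 * sqrt (x i)"
      by (rule eventually_mono[OF order_tendstoD(2)[OF lim, of 1]]) (use True in simp, rule bound)
  qed simp
  then show ?thesis using True by simp
qed

text \<open>
  Since \<open>x ln x \<ge> -1\<close> and the measure is finite, Fatou's lemma applies to \<open>x ln x + 1\<close>.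
\<close>

lemma entropy_lower_semicontinuous:
  fixes x :: "nat \<Rightarrow> 'a \<Rightarrow> real"
  assumes M: "finite_measure M" and z: "z \<in> borel_measurable M"
    and pos: "\<And>n t. 0 < x n t"
    and lim: "AE t in M. (\<lambda>n. x n t) \<longlonglongrightarrow> z t"
    and int: "\<And>n. integrable M (\<lambda>t. x n t * ln (x n t))"
    and le: "\<And>n. (LINT t|M. x n t * ln (x n t)) \<le> c"
  shows "integrable M (\<lambda>t. z t * ln (z t))" and "(LINT t|M. z t * ln (z t)) \<le> c"
proof -
  interpret finite_measure M by (rule M)
  let ?m = "measure M (space M)"
  have z_nonneg: "AE t in M. 0 \<le> z t"
    using lim by eventually_elim (rule LIMSEQ_le_const, use pos in \<open>auto intro: less_imp_le\<close>)
  have meas: "(\<lambda>t. z t * ln (z t)) \<in> borel_measurable M" using z by measurable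
  have nn: "AE t in M. 0 \<le> z t * ln (z t) + 1"
    using z_nonneg by eventually_elim (use mult_ln_lower in force)
  have c: "0 \<le> c + ?m"
  proof -
    have "0 \<le> (LINT t|M. x 0 t * ln (x 0 t) + 1)"
      using mult_ln_lower[of "x 0 _"] pos[of 0] by (intro integral_nonneg_AE AE_I2) (smt (verit))
    also have "\<dots> = (LINT t|M. x 0 t * ln (x 0 t)) + ?m" using int by simp
    finally show ?thesis using le[of 0] by simp
  qed
  have "(\<integral>\<^sup>+t. ennreal (z t * ln (z t) + 1) \<partial>M)
      = (\<integral>\<^sup>+t. liminf (\<lambda>n. ennreal (x n t * ln (x n t) + 1)) \<partial>M)"
  proof (rule nn_integral_cong_AE)
    show "AE t in M. ennreal (z t * ln (z t) + 1) = liminf (\<lambda>n. ennreal (x n t * ln (x n t) + 1))"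
      using lim z_nonneg
    proof eventually_elim
      case (elim t)
      have "(\<lambda>n. ennreal (x n t * ln (x n t) + 1)) \<longlonglongrightarrow> ennreal (z t * ln (z t) + 1)"
        by (intro tendsto_ennrealI tendsto_add tendsto_mult_ln tendsto_const elim pos)
      then show ?case by (intro lim_imp_Liminf[symmetric]) auto
    qed
  qed
  also have "\<dots> \<le> liminf (\<lambda>n. \<integral>\<^sup>+t. ennreal (x n t * ln (x n t) + 1) \<partial>M)"
    using int by (intro nn_integral_liminf) auto
  also have "\<dots> \<le> liminf (\<lambda>n. ennreal (c + ?m))"
  proof (intro Liminf_mono always_eventually allI)
    fix n
    have "(\<integral>\<^sup>+t. ennreal (x n t * ln (x n t) + 1) \<partial>M) = ennreal (LINT t|M. x n t * ln (x n t) + 1)"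
      using int mult_ln_lower[of "x n _"] pos[of n]
      by (intro nn_integral_eq_integral AE_I2) (auto, smt (verit))
    also have "\<dots> \<le> ennreal (c + ?m)"
      using le[of n] int by (intro ennreal_leI) simp
    finally show "(\<integral>\<^sup>+t. ennreal (x n t * ln (x n t) + 1) \<partial>M) \<le> ennreal (c + ?m)" .
  qed
  also have "\<dots> = ennreal (c + ?m)" by (simp add: Liminf_const)
  finally have bound: "(\<integral>\<^sup>+t. ennreal (z t * ln (z t) + 1) \<partial>M) \<le> ennreal (c + ?m)" .
  have int1: "integrable M (\<lambda>t. z t * ln (z t) + 1)"
    using meas nn bound by (intro integrableI_nonneg) (auto intro: order.strict_trans1)
  have "integrable M (\<lambda>t. (z t * ln (z t) + 1) - 1)"
    using int1 by (intro Bochner_Integration.integrable_diff) auto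
  then show int: "integrable M (\<lambda>t. z t * ln (z t))" by simp
  have "ennreal (LINT t|M. z t * ln (z t) + 1) \<le> ennreal (c + ?m)"
    using bound nn int1 by (simp add: nn_integral_eq_integral)
  then show "(LINT t|M. z t * ln (z t)) \<le> c"
    using int c by (simp add: ennreal_le_iff)
qed

section \<open>Gradient descent with a perturbed gradient\<close>

locale noisy_gradient_descent =
  fixes D :: "'b::real_inner \<Rightarrow> real" and grad :: "'b \<Rightarrow> 'b" and L \<gamma> \<delta> :: real
    and \<eta> :: 'b and l :: "nat \<Rightarrow> 'b"
  assumes convex: "\<And>u v. D u + inner (v - u) (grad u) \<le> D v"
    and smooth: "\<And>u v. D v \<le> D u + inner (v - u) (grad u) + L / 2 * (norm (v - u))\<^sup>2"
    and nonneg: "\<And>u. 0 \<le> D u"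
    and step_pos: "0 < \<gamma>" and step_le: "\<gamma> * L \<le> 1"
    and noise: "norm \<eta> \<le> \<delta>"
    and start: "l 0 = 0"
    and step: "\<And>n. l (Suc n) = l n - \<gamma> *\<^sub>R (grad (l n) - \<eta>)"
begin

text \<open>
  The iteration is exact gradient descent for this function.
\<close>

definition perturbed :: "'b \<Rightarrow> real" where "perturbed u = D u - inner u \<eta>"

definition residual :: "nat \<Rightarrow> 'b" where "residual n = grad (l n) - \<eta>"

lemma noise_nonneg: "0 \<le> \<delta>"
  using noise norm_ge_zero[of \<eta>] by linarith

lemma perturbed_decrease: "perturbed (l (Suc n)) \<le> perturbed (l n) - \<gamma> / 2 * (norm (residual n))\<^sup>2"
proof -
  have "D (l (Suc n)) \<le> D (l n) - \<gamma> * inner (residual n) (grad (l n)) + L / 2 * (\<gamma>\<^sup>2 * (norm (residual n))\<^sup>2)"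
    using smooth[of "l (Suc n)" "l n"] step_pos
    by (simp add: step flip: residual_def) (simp add: power_mult_distrib)
  moreover have "inner (l (Suc n)) \<eta> = inner (l n) \<eta> - \<gamma> * inner (residual n) \<eta>"
    by (simp add: step inner_diff_left flip: residual_def)
  moreover have "inner (residual n) (grad (l n)) = inner (residual n) \<eta> + (norm (residual n))\<^sup>2"
    by (simp add: residual_def inner_diff_right inner_diff_left power2_norm_eq_inner)
  moreover have "L / 2 * (\<gamma>\<^sup>2 * (norm (residual n))\<^sup>2) \<le> \<gamma> / 2 * (norm (residual n))\<^sup>2"
  proof -
    have "(\<gamma> * L) * (\<gamma> / 2 * (norm (residual n))\<^sup>2) \<le> 1 * (\<gamma> / 2 * (norm (residual n))\<^sup>2)"
      using step_le step_pos by (intro mult_right_mono) auto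
    then show ?thesis by (simp add: power2_eq_square algebra_simps)
  qed
  ultimately show ?thesis by (simp add: perturbed_def algebra_simps)
qed

text \<open>
  Convexity bounds the change of \<open>\<parallel>l n - v\<parallel>\<^sup>2\<close> by the difference of values, up to \<open>\<gamma>\<^sup>2 \<parallel>residual n\<parallel>\<^sup>2\<close>, which the
  decrease of the function pays for. As the values decrease, the last one may replace all of
  them in the telescoped sum.
\<close>

lemma energy: "2 * \<gamma> * real n * (perturbed (l n) - perturbed v) + (norm (l n - v))\<^sup>2 \<le> (norm v)\<^sup>2"
proof (induction n)
  case 0
  then show ?case by (simp add: start)
next
  case (Suc n)
  have conv: "perturbed (l n) - perturbed v \<le> inner (l n - v) (residual n)"
    using convex[of "l n" v] by (simp add: perturbed_def residual_def algebra_simps inner_diff_left inner_diff_right)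
  have "(norm (l (Suc n) - v))\<^sup>2
      = (norm (l n - v))\<^sup>2 - 2 * \<gamma> * inner (l n - v) (residual n) + \<gamma>\<^sup>2 * (norm (residual n))\<^sup>2"
    unfolding power2_norm_eq_inner
    by (simp add: step inner_diff_left inner_diff_right inner_commute power2_eq_square[of \<gamma>]
        algebra_simps flip: residual_def)
  moreover have "2 * \<gamma> * (perturbed (l n) - perturbed v) \<le> 2 * \<gamma> * inner (l n - v) (residual n)"
    using conv step_pos by simp
  moreover have "2 * \<gamma> * perturbed (l (Suc n)) \<le> 2 * \<gamma> * perturbed (l n) - \<gamma>\<^sup>2 * (norm (residual n))\<^sup>2"
    using mult_left_mono[OF perturbed_decrease[of n], of "2 * \<gamma>"] step_pos
    by (simp add: power2_eq_square algebra_simps)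
  moreover have "2 * \<gamma> * real n * perturbed (l (Suc n)) \<le> 2 * \<gamma> * real n * perturbed (l n)"
  proof (intro mult_left_mono)
    show "perturbed (l (Suc n)) \<le> perturbed (l n)"
      using perturbed_decrease[of n] step_pos by (smt (verit) divide_nonneg_nonneg mult_nonneg_nonneg zero_le_power2)
  qed (use step_pos in simp)
  ultimately show ?case using Suc by (simp add: algebra_simps)
qed

lemma perturbed_diff: "D (l n) - D v \<le> perturbed (l n) - perturbed v + \<delta> * norm (l n - v)"
proof -
  have "inner (l n - v) \<eta> \<le> norm (l n - v) * \<delta>"
    using norm_cauchy_schwarz[of "l n - v" \<eta>] mult_left_mono[OF noise, of "norm (l n - v)"] by simp
  then show ?thesis by (simp add: perturbed_def inner_diff_left algebra_simps)
qed

text \<open>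
  Passing from the perturbed function back to \<open>D\<close> costs \<open>\<delta> \<parallel>l n - v\<parallel>\<close>. Keeping the term \<open>\<parallel>l n - v\<parallel>\<^sup>2\<close> in the
  energy inequality is what absorbs this cost.
\<close>

lemma a_priori_estimate:
  "2 * \<gamma> * real n * D (l n) \<le> 2 * \<gamma> * real n * D v + (norm v)\<^sup>2 + (\<gamma> * real n * \<delta>)\<^sup>2"
proof -
  let ?s = "norm (l n - v)"
  have "2 * \<gamma> * real n * (D (l n) - D v) \<le> 2 * \<gamma> * real n * (perturbed (l n) - perturbed v + \<delta> * ?s)"
    using perturbed_diff[of n v] step_pos by (intro mult_left_mono) auto
  moreover have "2 * (\<gamma> * real n * \<delta>) * ?s \<le> (\<gamma> * real n * \<delta>)\<^sup>2 + ?s\<^sup>2"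
    using sum_squares_bound by blast
  ultimately show ?thesis using energy[of n v] by (simp add: algebra_simps)
qed

context
  fixes \<tau> :: real
  assumes tau: "1 < \<tau>" and tau_step: "\<gamma> * L < 1 - 2 / \<tau>"
  assumes L_nonneg: "0 \<le> L"
begin

lemma tau_gt_2: "2 < \<tau>"
proof -
  have "2 / \<tau> < 1" using tau_step mult_nonneg_nonneg[of \<gamma> L] step_pos L_nonneg by linarith
  then show ?thesis using tau by simp
qed

text \<open>
  While the residual exceeds \<open>\<tau> \<delta>\<close>, the noise is at most the fraction \<open>1 / \<tau>\<close> of it, and the step
  condition leaves a decrease of \<open>\<gamma> / 2 \<parallel>residual n\<parallel>\<^sup>2\<close> for the unperturbed function. The constant
  uses \<open>\<tau> > 2\<close>.
\<close>

lemma D_decrease: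
  assumes "\<tau> * \<delta> < norm (residual n)"
  shows "D (l (Suc n)) + 2 * \<gamma> * \<delta>\<^sup>2 \<le> D (l n)"
proof -
  let ?r = "norm (residual n)"
  have "D (l (Suc n)) \<le> D (l n) - \<gamma> * inner (residual n) (grad (l n)) + L / 2 * (\<gamma>\<^sup>2 * ?r\<^sup>2)"
    using smooth[of "l (Suc n)" "l n"] step_pos
    by (simp add: step flip: residual_def) (simp add: power_mult_distrib)
  moreover have "inner (residual n) (grad (l n)) = inner (residual n) \<eta> + ?r\<^sup>2"
    by (simp add: residual_def inner_diff_right inner_diff_left power2_norm_eq_inner)
  moreover have "- (?r\<^sup>2 / \<tau>) \<le> inner (residual n) \<eta>"
  proof -
    have "norm \<eta> \<le> ?r / \<tau>" using order.strict_trans1[OF mult_left_mono[OF noise, of \<tau>] assms] tau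
      by (simp add: field_simps)
    then have "?r * norm \<eta> \<le> ?r * (?r / \<tau>)" by (intro mult_left_mono) auto
    then show ?thesis using norm_cauchy_schwarz[of "- residual n" \<eta>] by (simp add: power2_eq_square)
  qed
  ultimately have "D (l (Suc n)) \<le> D (l n) - \<gamma> * ?r\<^sup>2 * (1 - 1 / \<tau> - \<gamma> * L / 2)"
    using step_pos mult_left_mono[of "- (?r\<^sup>2 / \<tau>)" "inner (residual n) \<eta>" \<gamma>]
    by (simp add: algebra_simps power2_eq_square)
  moreover have "\<gamma> * ?r\<^sup>2 * (1 / 2) \<le> \<gamma> * ?r\<^sup>2 * (1 - 1 / \<tau> - \<gamma> * L / 2)"
    using tau_step step_pos by (intro mult_left_mono) auto
  moreover have "(2 * \<delta>)\<^sup>2 \<le> ?r\<^sup>2"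
    using assms noise_nonneg tau_gt_2 mult_right_mono[of 2 \<tau> \<delta>] by (intro power_mono) linarith+
  then have "\<gamma> * (4 * \<delta>\<^sup>2) \<le> \<gamma> * ?r\<^sup>2"
    using step_pos by (intro mult_left_mono) (auto simp: power_mult_distrib)
  ultimately show ?thesis by simp
qed

lemma D_decrease_iterated:
  assumes "\<forall>n<N. \<tau> * \<delta> < norm (residual n)" and "m \<le> N"
  shows "D (l N) + 2 * \<gamma> * \<delta>\<^sup>2 * real (N - m) \<le> D (l m)"
  using assms(2,1)
proof (induction N rule: dec_induct)
  case base
  then show ?case by simp
next
  case (step k)
  then have "D (l (Suc k)) + 2 * \<gamma> * \<delta>\<^sup>2 \<le> D (l k)" by (intro D_decrease) simp
  moreover have "real (Suc k - m) = real (k - m) + 1" using step by simp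
  ultimately show ?case using step by (simp add: algebra_simps)
qed

lemma stopping_index_exists:
  assumes "0 < \<delta>"
  shows "\<exists>N. norm (residual N) \<le> \<tau> * \<delta>"
proof (rule ccontr)
  assume "\<not> ?thesis"
  then have "2 * \<gamma> * \<delta>\<^sup>2 * real N \<le> D (l 0)" for N
    using D_decrease_iterated[of N 0] nonneg[of "l N"] by (simp add: not_le)
  moreover obtain N where "D (l 0) < real N * (2 * \<gamma> * \<delta>\<^sup>2)"
    using reals_Archimedean3[of "2 * \<gamma> * \<delta>\<^sup>2"] assms step_pos by auto
  ultimately show False by (metis mult.commute not_le)
qed

text \<open>
  In the second half of the run \<open>D\<close> decreases by at least \<open>2 \<gamma> \<delta>\<^sup>2\<close> per step and stays nonnegative, so
  \<open>2 \<gamma> m \<delta>\<^sup>2 \<le> D (l m)\<close> for \<open>m = N div 2\<close>. The a priori estimate bounds \<open>D (l m)\<close> with the smaller noise term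
  \<open>\<gamma> m \<delta>\<^sup>2 / 2\<close>; the difference is a quadratic inequality for \<open>a = \<gamma> m \<delta>\<^sup>2\<close>.
\<close>

lemma stopping_index_bound:
  assumes "\<forall>n<N. \<tau> * \<delta> < norm (residual n)"
  shows "\<gamma> * real N * \<delta>\<^sup>2 \<le> 2 * D v + 2 * \<delta> * norm v + \<gamma> * \<delta>\<^sup>2"
proof -
  define m where "m = N div 2"
  define a where "a = \<gamma> * real m * \<delta>\<^sup>2"
  have N: "real N \<le> 2 * real m + 1" "real m \<le> real (N - m)" unfolding m_def by linarith+
  have a0: "0 \<le> a" using step_pos by (simp add: a_def)
  have "2 * \<gamma> * \<delta>\<^sup>2 * real m \<le> 2 * \<gamma> * \<delta>\<^sup>2 * real (N - m)"
    using N step_pos by (intro mult_left_mono) auto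
  also have "\<dots> \<le> D (l m)"
    using D_decrease_iterated[OF assms, of m] nonneg[of "l N"] by (simp add: m_def)
  finally have "2 * a \<le> D (l m)" by (simp add: a_def algebra_simps)
  then have "2 * a * (2 * a) \<le> 2 * a * D (l m)" using a0 by (intro mult_left_mono) auto
  also have "\<dots> = \<delta>\<^sup>2 * (2 * \<gamma> * real m * D (l m))" by (simp add: a_def)
  also have "\<dots> \<le> \<delta>\<^sup>2 * (2 * \<gamma> * real m * D v + (norm v)\<^sup>2 + (\<gamma> * real m * \<delta>)\<^sup>2)"
    by (intro mult_left_mono a_priori_estimate) auto
  also have "\<dots> = 2 * a * D v + (\<delta> * norm v)\<^sup>2 + a * a"
    by (simp add: a_def power2_eq_square algebra_simps)
  finally have key: "3 * a * a \<le> 2 * a * D v + (\<delta> * norm v)\<^sup>2" by (simp add: algebra_simps)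
  have "a \<le> D v + \<delta> * norm v"
  proof (rule ccontr)
    assume big: "\<not> ?thesis"
    have dv: "0 \<le> \<delta> * norm v" using noise_nonneg by simp
    have "a * D v \<le> a * a" using big dv a0 by (intro mult_left_mono) auto
    moreover have "(\<delta> * norm v) * (\<delta> * norm v) < a * a"
      using big dv nonneg[of v] by (intro mult_strict_mono') auto
    ultimately show False using key by (simp add: power2_eq_square)
  qed
  moreover have "\<gamma> * \<delta>\<^sup>2 * real N \<le> \<gamma> * \<delta>\<^sup>2 * (2 * real m + 1)"
    using N step_pos by (intro mult_left_mono) auto
  ultimately show ?thesis by (simp add: a_def algebra_simps)
qed

text \<open>
  By convexity \<open>D (l N) - D v \<le> \<parallel>l N - v\<parallel> \<parallel>grad (l N)\<parallel>\<close>, and at the stopping index the gradient is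
  at most \<open>(\<tau> + 1) \<delta>\<close>. It remains to bound \<open>b = \<delta> \<parallel>l N - v\<parallel>\<close>: the energy inequality is quadratic
  in \<open>b\<close> with coefficients controlled by \<open>N \<delta>\<^sup>2\<close>. The argument also covers small \<open>N\<close>, for which the
  a priori estimate gives nothing.
\<close>

lemma discrepancy_estimate:
  assumes before: "\<forall>n<N. \<tau> * \<delta> < norm (residual n)" and stop: "norm (residual N) \<le> \<tau> * \<delta>"
  shows "D (l N) \<le> (5 * \<tau> + 6) * D v + (\<tau> + 1) * (5 * \<delta> * norm v + 2 * \<gamma> * \<delta>\<^sup>2)"
proof -
  define s where "s = norm (l N - v)"
  define b where "b = \<delta> * s"
  define W where "W = 2 * \<gamma> * real N * \<delta>\<^sup>2"
  have pos: "0 \<le> b" "0 \<le> W" "0 \<le> \<delta> * norm v" "0 \<le> D v"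
    using noise_nonneg step_pos nonneg by (simp_all add: b_def s_def W_def)
  have "s\<^sup>2 \<le> (norm v)\<^sup>2 + 2 * \<gamma> * real N * (perturbed v - perturbed (l N))"
    using energy[of N v] by (simp add: s_def algebra_simps)
  also have "\<dots> \<le> (norm v)\<^sup>2 + 2 * \<gamma> * real N * (D v + b)"
    using perturbed_diff[of N v] nonneg[of "l N"] step_pos
    by (intro add_left_mono mult_left_mono) (auto simp: b_def s_def)
  finally have "\<delta>\<^sup>2 * s\<^sup>2 \<le> \<delta>\<^sup>2 * ((norm v)\<^sup>2 + 2 * \<gamma> * real N * (D v + b))"
    by (intro mult_left_mono) auto
  then have key: "b * b \<le> (\<delta> * norm v) * (\<delta> * norm v) + W * D v + W * b"
    by (simp add: b_def W_def power2_eq_square algebra_simps)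
  have "b \<le> \<delta> * norm v + W + D v"
  proof (rule ccontr)
    assume big: "\<not> ?thesis"
    have "b * (\<delta> * norm v + W + D v) < b * b"
      using big pos by (intro mult_strict_left_mono) auto
    moreover have "(\<delta> * norm v) * (\<delta> * norm v) \<le> b * (\<delta> * norm v)" "W * D v \<le> b * D v"
      using big pos by (auto intro!: mult_right_mono)
    ultimately show False using key by (simp add: algebra_simps)
  qed
  moreover have "W \<le> 2 * (2 * D v + 2 * \<delta> * norm v + \<gamma> * \<delta>\<^sup>2)"
    using stopping_index_bound[OF before, of v] by (simp add: W_def)
  ultimately have b: "b \<le> 5 * D v + 5 * \<delta> * norm v + 2 * \<gamma> * \<delta>\<^sup>2" by simp
  have "norm (grad (l N)) \<le> (\<tau> + 1) * \<delta>"
    using norm_triangle_ineq[of "residual N" \<eta>] stop noise by (simp add: residual_def algebra_simps)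
  then have "s * norm (grad (l N)) \<le> s * ((\<tau> + 1) * \<delta>)"
    by (intro mult_left_mono) (auto simp: s_def)
  moreover have "D (l N) \<le> D v + inner (l N - v) (grad (l N))"
    using convex[of "l N" v] by (simp add: inner_diff_left)
  ultimately have "D (l N) \<le> D v + (\<tau> + 1) * b"
    using norm_cauchy_schwarz[of "l N - v" "grad (l N)"] by (simp add: b_def s_def algebra_simps)
  also have "\<dots> \<le> D v + (\<tau> + 1) * (5 * D v + 5 * \<delta> * norm v + 2 * \<gamma> * \<delta>\<^sup>2)"
    using b tau by simp
  finally show ?thesis by (simp add: algebra_simps)
qed

end

end

section \<open>Absence of a duality gap\<close>

locale entropic_problem = entropic_operator \<Omega> A
  for \<Omega> :: "'a::euclidean_space set" and A :: "('a \<Rightarrow> real) \<Rightarrow> 'b::real_inner" +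
  fixes y :: 'b and xdag :: "'a \<Rightarrow> real"
  assumes xdag_entropy: "finite_entropy xdag" and A_xdag: "A xdag = y"
    and xdag_minimal: "\<And>x. finite_entropy x \<Longrightarrow> A x = y \<Longrightarrow> entropy xdag \<le> entropy x"
begin

text \<open>
  The value \<open>\<langle>l, y\<rangle> - log_partition l\<close> is the dual objective at \<open>l\<close>, so this is the duality gap; it
  is also the Kullback-Leibler divergence of \<open>xdag\<close> from \<open>X l\<close>.
\<close>

definition gap :: "'b \<Rightarrow> real" where
  "gap l = entropy xdag - inner l y + log_partition l"

definition grad :: "'b \<Rightarrow> 'b" where "grad l = A (X l) - y"

lemma error_square_le_gap: "(L1_norm \<Omega> (\<lambda>t. X l t - xdag t))\<^sup>2 \<le> 2 * gap l"
  using pinsker[OF xdag_entropy, of l]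
  by (simp add: gap_def A_xdag L1_norm_def abs_minus_commute)

lemma gap_nonneg: "0 \<le> gap l"
  using error_square_le_gap[of l] zero_le_power2[of "L1_norm \<Omega> (\<lambda>t. X l t - xdag t)"] by linarith

lemma gap_strong_convex:
  "gap l + inner (u - l) (grad l) + (L1_norm \<Omega> (\<lambda>t. X l t - X u t))\<^sup>2 / 2 \<le> gap u"
  using log_partition_strong_convex[of l u]
  by (simp add: gap_def grad_def inner_diff_left inner_diff_right)

lemma gap_convex: "gap l + inner (u - l) (grad l) \<le> gap u"
  using log_partition_convex[of l u] by (simp add: gap_def grad_def inner_diff_left inner_diff_right)

lemma gap_smooth: "gap u \<le> gap l + inner (u - l) (grad l) + opnorm\<^sup>2 / 2 * (norm (u - l))\<^sup>2"
  using log_partition_smooth[of u l] by (simp add: gap_def grad_def inner_diff_left inner_diff_right)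

lemma continuous_gap_segment: "continuous_on {0..1} (\<lambda>t. gap (t *\<^sub>R l))"
proof -
  define C where "C = norm l * (opnorm + norm y)"
  have g: "norm (grad u) \<le> opnorm + norm y" for u
    using norm_triangle_ineq4[of "A (X u)" y] norm_A_le[OF X_L1, of u] by (simp add: grad_def L1_norm_X)
  have le: "gap (s *\<^sub>R l) - gap (t *\<^sub>R l) \<le> C * \<bar>s - t\<bar>" for s t
  proof -
    have "inner ((s - t) *\<^sub>R l) (grad (s *\<^sub>R l)) \<le> norm ((s - t) *\<^sub>R l) * (opnorm + norm y)"
      by (rule order_trans[OF norm_cauchy_schwarz]) (intro mult_left_mono g, simp)
    also have "\<dots> = C * \<bar>s - t\<bar>" by (simp add: C_def)
    finally show ?thesis
      using gap_convex[of "s *\<^sub>R l" "t *\<^sub>R l"]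
      by (simp add: inner_diff_left left_diff_distrib)
  qed
  have "(C)-lipschitz_on {0..1} (\<lambda>t. gap (t *\<^sub>R l))"
  proof (rule lipschitz_onI)
    show "0 \<le> C" using opnorm_nonneg by (simp add: C_def)
    fix s t
    show "dist (gap (s *\<^sub>R l)) (gap (t *\<^sub>R l)) \<le> C * dist s t"
      using le[of s t] le[of t s] by (simp add: dist_real_def abs_le_iff abs_minus_commute)
  qed
  then show ?thesis by (rule lipschitz_on_continuous_on)
qed

text \<open>
  A minimizer of the gap on the segment from \<open>0\<close> to \<open>l\<close> has nonpositive derivative along its own
  direction, since one can still move towards \<open>0\<close>. The sign is what is needed to bound the
  entropy of \<open>X u\<close>, which equals \<open>entropy xdag - gap u + \<langle>u, grad u\<rangle>\<close>.
\<close>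

lemma segment_minimizer:
  obtains u where "gap u \<le> gap l" and "inner u (grad u) \<le> 0"
proof -
  obtain t where t: "t \<in> {0..1}" "\<And>s. s \<in> {0..1} \<Longrightarrow> gap (t *\<^sub>R l) \<le> gap (s *\<^sub>R l)"
    using continuous_attains_inf[OF _ _ continuous_gap_segment[of l]] by fastforce
  have "inner (t *\<^sub>R l) (grad (t *\<^sub>R l)) \<le> 0"
  proof (cases "t = 0")
    case False
    define c where "c = opnorm\<^sup>2 / 2 * (norm (t *\<^sub>R l))\<^sup>2"
    have "inner (t *\<^sub>R l) (grad (t *\<^sub>R l)) \<le> c * h" if h: "0 < h" "h < 1" for h
    proof -
      have "(1 - h) * t \<in> {0..1}" using t(1) h by (auto intro: mult_le_one)
      from t(2)[OF this] gap_smooth[of "((1 - h) * t) *\<^sub>R l" "t *\<^sub>R l"]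
      have "0 \<le> inner (- h *\<^sub>R (t *\<^sub>R l)) (grad (t *\<^sub>R l)) + opnorm\<^sup>2 / 2 * (norm (- h *\<^sub>R (t *\<^sub>R l)))\<^sup>2"
        by (simp add: algebra_simps)
      also have "\<dots> = h * (c * h - inner (t *\<^sub>R l) (grad (t *\<^sub>R l)))"
        by (simp add: c_def power_mult_distrib power2_eq_square algebra_simps)
      finally show ?thesis using h by (simp add: zero_le_mult_iff)
    qed
    then have "\<forall>\<^sub>F h in at_right 0. inner (t *\<^sub>R l) (grad (t *\<^sub>R l)) \<le> c * h"
      using eventually_at_right_real[of 0 1] by (auto elim!: eventually_mono)
    moreover have "((\<lambda>h. c * h) \<longlongrightarrow> c * 0) (at_right 0)"
      by (intro tendsto_intros)
    ultimately show ?thesis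
      using tendsto_lowerbound[of "\<lambda>h. c * h" "c * 0" "at_right 0"] by simp
  qed simp
  then show thesis using that t(2)[of 1] by simp
qed

text \<open>
  Strong duality. Along a minimizing sequence \<open>u n\<close> the densities \<open>X (u n)\<close> form a Cauchy sequence in \<open>L\<^sup>1\<close>,
  by strong convexity at the midpoints. Gradients tend to zero because one gradient step
  cannot take the gap below its infimum \<open>d\<close>; hence the limit \<open>z\<close> satisfies \<open>A z = y\<close>. The points \<open>u n\<close> are
  chosen as minimizers on segments from \<open>0\<close>, so that their entropies, and by semicontinuity that of \<open>z\<close>, are at most
  \<open>entropy xdag - d\<close>. As \<open>xdag\<close> is minimal, \<open>d \<le> 0\<close>.
\<close>

lemma gap_arbitrarily_small:
  assumes "0 < \<epsilon>"
  obtains l where "gap l < \<epsilon>"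
proof -
  define d where "d = (INF l. gap l)"
  have bdd: "bdd_below (range gap)" by (rule bdd_belowI2[of _ 0]) (rule gap_nonneg)
  have d_le: "d \<le> gap l" for l unfolding d_def by (rule cINF_lower[OF bdd]) simp
  have near: "\<exists>u. gap u < d + \<epsilon> \<and> inner u (grad u) \<le> 0" if "\<epsilon> > 0" for \<epsilon>
  proof -
    obtain l where l: "gap l < d + \<epsilon>"
      using cInf_lessD[of "range gap" "d + \<epsilon>"] \<open>\<epsilon> > 0\<close> by (auto simp: d_def)
    obtain u where "gap u \<le> gap l" "inner u (grad u) \<le> 0" by (rule segment_minimizer)
    then show ?thesis using l by (intro exI[of _ u]) simp
  qed
  \<comment> \<open>The squared distance of two densities is at most four times the sum of their excesses over \<open>d\<close>,
    so this tolerance gives increments of at most \<open>(1 / 2) ^ n\<close>.\<close>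
  have "\<forall>n. \<exists>u. gap u < d + (1 / 4) ^ n / 8 \<and> inner u (grad u) \<le> 0"
    by (intro allI near) simp
  from choice[OF this] obtain u
    where u: "gap (u n) < d + (1 / 4) ^ n / 8" "inner (u n) (grad (u n)) \<le> 0" for n by blast
  have Cauchy: "(LINT t|M. \<bar>X (u (Suc n)) t - X (u n) t\<bar>) \<le> (1 / 2) ^ n" for n
  proof -
    define a b where "a = u n" and "b = u (Suc n)"
    \<comment> \<open>The first-order terms at the midpoint cancel, leaving only the two distances and \<open>gap m \<ge> d\<close>.\<close>
    define m where "m = (1 / 2) *\<^sub>R (a + b)"
    define p q where "p = L1_norm \<Omega> (\<lambda>t. X m t - X a t)" and "q = L1_norm \<Omega> (\<lambda>t. X m t - X b t)"
    have XM: "integrable M (X v)" for v using X_L1[of v] by (simp add: L1_def)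
    have "a - m = - (b - m)" by (simp add: m_def scaleR_2[symmetric] algebra_simps flip: scaleR_left_distrib)
    then have "inner (a - m) (grad m) + inner (b - m) (grad m) = 0"
      by (simp add: inner_diff_left)
    then have "p\<^sup>2 + q\<^sup>2 \<le> 2 * (gap a + gap b - 2 * d)"
      using gap_strong_convex[of m a] gap_strong_convex[of m b] d_le[of m] by (simp add: p_def q_def)
    also have "\<dots> \<le> 2 * ((1 / 4) ^ n / 8 + (1 / 4) ^ n / 8)"
    proof -
      have "(1 / 4 :: real) ^ Suc n \<le> (1 / 4) ^ n" by (intro power_decreasing) auto
      then show ?thesis using u(1)[of n] u(1)[of "Suc n"] unfolding a_def b_def by argo
    qed
    finally have pq: "p\<^sup>2 + q\<^sup>2 \<le> (1 / 4) ^ n / 2" by simp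
    have "(p + q)\<^sup>2 \<le> 2 * (p\<^sup>2 + q\<^sup>2)"
      using zero_le_power2[of "p - q"] by (simp add: power2_eq_square algebra_simps)
    also have "\<dots> \<le> (1 / 4) ^ n" using pq by simp
    also have "\<dots> = ((1 / 2) ^ n)\<^sup>2" by (simp add: power2_eq_square flip: power_mult_distrib)
    finally have "p + q \<le> (1 / 2) ^ n" by (rule power2_le_imp_le) simp
    moreover have "(LINT t|M. \<bar>X b t - X a t\<bar>) \<le> (LINT t|M. \<bar>X m t - X a t\<bar> + \<bar>X m t - X b t\<bar>)"
      using XM by (intro integral_mono) auto
    moreover have "\<dots> = p + q" unfolding p_def q_def L1_norm_def
      using XM by (intro Bochner_Integration.integral_add) auto
    ultimately show ?thesis by (simp add: a_def b_def)
  qed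
  obtain z where z: "integrable M z" "AE t in M. (\<lambda>n. X (u n) t) \<longlonglongrightarrow> z t"
    and z_lim: "(\<lambda>n. LINT t|M. \<bar>X (u n) t - z t\<bar>) \<longlonglongrightarrow> 0"
    using L1_limit_of_fast_Cauchy_sequence[of M "\<lambda>n. X (u n)", OF _ Cauchy] X_L1
    by (auto simp: L1_def)
  have zL1: "z \<in> L1 \<Omega>" using z by (simp add: L1_def)
  have ent_le: "entropy (X (u n)) \<le> entropy xdag - d" for n
    using u(2)[of n] d_le[of "u n"] by (simp add: entropy_X gap_def grad_def inner_diff_right)
  have z_int: "integrable M (\<lambda>t. z t * ln (z t))" and z_ent: "entropy z \<le> entropy xdag - d"
    using entropy_lower_semicontinuous[OF finite_measure_axioms _ X_pos z(2), of "entropy xdag - d"] z(1)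
      X_finite_entropy ent_le
    by (auto simp: finite_entropy_def L1_def entropy_def)
  have "(\<lambda>n. (LINT t|M. X (u n) t)) \<longlonglongrightarrow> (LINT t|M. z t)"
  proof (rule LIM_zero_cancel, rule Lim_null_comparison[OF always_eventually z_lim], rule allI)
    fix n
    have "(LINT t|M. X (u n) t) - (LINT t|M. z t) = (LINT t|M. X (u n) t - z t)"
      using z(1) X_L1[of "u n"] by (simp add: L1_def)
    then show "norm ((LINT t|M. X (u n) t) - (LINT t|M. z t)) \<le> (LINT t|M. \<bar>X (u n) t - z t\<bar>)"
      using integral_norm_bound[of M "\<lambda>t. X (u n) t - z t"] by (simp only: real_norm_def)
  qed
  then have "(LINT t|M. z t) = 1" by (simp add: X_integral LIMSEQ_const_iff)
  moreover have "AE t in M. 0 \<le> z t"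
    using z(2) by eventually_elim (rule LIMSEQ_le_const, use X_pos in \<open>auto intro: less_imp_le\<close>)
  ultimately have z_fin: "finite_entropy z"
    using zL1 z_int by (simp add: finite_entropy_def prob_densities_def L1_def)
  have "(\<lambda>n. A (X (u n))) \<longlonglongrightarrow> A z"
  proof (rule LIM_zero_cancel, rule Lim_null_comparison[OF always_eventually], rule allI)
    fix n
    show "norm (A (X (u n)) - A z) \<le> opnorm * (LINT t|M. \<bar>X (u n) t - z t\<bar>)"
      using norm_A_le[of "\<lambda>t. X (u n) t - z t"] X_L1[of "u n"] zL1 A_diff[OF X_L1 zL1, of "u n"]
      by (simp add: L1_def L1_norm_def)
  qed (use tendsto_mult_right_zero[OF z_lim] in simp)
  moreover have "(\<lambda>n. A (X (u n))) \<longlonglongrightarrow> y"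
  proof (rule LIM_zero_cancel, rule Lim_null_comparison[OF always_eventually], rule allI)
    fix n
    \<comment> \<open>The summand 1 avoids a division by zero when the operator vanishes.\<close>
    define \<gamma> where "\<gamma> = 1 / (opnorm\<^sup>2 + 1)"
    define g where "g = grad (u n)"
    have op: "0 < opnorm\<^sup>2 + 1" using zero_le_power2[of opnorm] by linarith
    then have \<gamma>: "0 < \<gamma>" "\<gamma> * opnorm\<^sup>2 \<le> 1"
      by (simp_all add: \<gamma>_def divide_le_eq)
    have "d \<le> gap (u n) - \<gamma> * (norm g)\<^sup>2 + opnorm\<^sup>2 / 2 * (\<gamma>\<^sup>2 * (norm g)\<^sup>2)"
      using d_le[of "u n - \<gamma> *\<^sub>R g"] gap_smooth[of "u n - \<gamma> *\<^sub>R g" "u n"] \<gamma>(1)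
      by (simp add: g_def power_mult_distrib power2_norm_eq_inner)
    also have "opnorm\<^sup>2 / 2 * (\<gamma>\<^sup>2 * (norm g)\<^sup>2) = (\<gamma> * opnorm\<^sup>2) * (\<gamma> / 2 * (norm g)\<^sup>2)"
      by (simp add: power2_eq_square)
    also have "\<dots> \<le> 1 * (\<gamma> / 2 * (norm g)\<^sup>2)" using \<gamma> by (intro mult_right_mono) auto
    finally have small: "\<gamma> / 2 * (norm g)\<^sup>2 \<le> (1 / 4) ^ n / 8" using u(1)[of n] by simp
    have "(norm g)\<^sup>2 = (opnorm\<^sup>2 + 1) * (2 * (\<gamma> / 2 * (norm g)\<^sup>2))"
    proof -
      have "(opnorm\<^sup>2 + 1) * \<gamma> = 1" using op by (simp add: \<gamma>_def)
      then show ?thesis by (simp flip: mult.assoc)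
    qed
    also have "\<dots> \<le> (opnorm\<^sup>2 + 1) * (1 / 4) ^ n"
    proof (intro mult_left_mono)
      have "0 \<le> (1 / 4 :: real) ^ n" by simp
      then show "2 * (\<gamma> / 2 * (norm g)\<^sup>2) \<le> (1 / 4) ^ n" using small by argo
    qed (use op in simp)
    finally have "(norm g)\<^sup>2 \<le> (opnorm\<^sup>2 + 1) * (1 / 4) ^ n" .
    then show "norm (A (X (u n)) - y) \<le> sqrt ((opnorm\<^sup>2 + 1) * (1 / 4) ^ n)"
      by (simp add: real_le_rsqrt g_def grad_def)
  next
    have "(\<lambda>n. sqrt ((opnorm\<^sup>2 + 1) * (1 / 4) ^ n)) \<longlonglongrightarrow> sqrt ((opnorm\<^sup>2 + 1) * 0)"
      by (intro tendsto_intros LIMSEQ_power_zero) simp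
    then show "(\<lambda>n. sqrt ((opnorm\<^sup>2 + 1) * (1 / 4) ^ n)) \<longlonglongrightarrow> 0" by simp
  qed
  ultimately have "A z = y" by (rule LIMSEQ_unique)
  then have "entropy xdag \<le> entropy z" by (rule xdag_minimal[OF z_fin])
  then have "d \<le> 0" using z_ent by simp
  moreover obtain v where "gap v < d + \<epsilon>" using near[OF assms] by blast
  ultimately have "gap v < \<epsilon>" by simp
  then show thesis by (rule that)
qed

lemma source_condition_imp_gap_zero:
  assumes "source_condition \<Omega> A xdag"
  obtains l where "gap l = 0"
proof -
  obtain l where "entropy xdag = inner l (A xdag) - log_partition l"
    by (rule source_condition_imp_dual_attained[OF xdag_entropy assms])
  then show thesis using that[of l] by (simp add: gap_def A_xdag)
qed

section \<open>Convergence of the dual gradient method\<close>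

lemma dual_iter_noisy_gradient_descent:
  assumes "0 < \<gamma>" "\<gamma> * opnorm\<^sup>2 \<le> 1" "norm (yd - y) \<le> \<delta>"
  shows "noisy_gradient_descent gap grad (opnorm\<^sup>2) \<gamma> \<delta> (yd - y) (dual_iter \<Omega> A \<gamma> yd)"
  by unfold_locales (use assms gap_convex gap_smooth gap_nonneg in \<open>auto simp: grad_def\<close>)

lemma error_le: "L1_norm \<Omega> (\<lambda>t. primal_iter \<Omega> A \<gamma> yd n t - xdag t) \<le> sqrt (2 * gap (dual_iter \<Omega> A \<gamma> yd n))"
  unfolding primal_iter_def by (rule real_le_rsqrt[OF error_square_le_gap])

text \<open>
  The comparison point \<open>v\<close> may be chosen with arbitrarily small gap before \<open>\<delta>\<close> tends to zero.
\<close>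

lemma error_tendsto_0:
  fixes n :: "real \<Rightarrow> nat" and yd :: "real \<Rightarrow> 'b" and B :: "'b \<Rightarrow> real \<Rightarrow> real"
  assumes bound: "\<And>v. \<forall>\<^sub>F \<delta> in at_right 0. gap (dual_iter \<Omega> A \<gamma> (yd \<delta>) (n \<delta>)) \<le> B v \<delta>"
    and lim: "\<And>v. (B v \<longlongrightarrow> c * gap v) (at_right 0)" and c: "0 < c"
  shows "((\<lambda>\<delta>. L1_norm \<Omega> (\<lambda>t. primal_iter \<Omega> A \<gamma> (yd \<delta>) (n \<delta>) t - xdag t)) \<longlongrightarrow> 0) (at_right 0)"
proof -
  have "((\<lambda>\<delta>. gap (dual_iter \<Omega> A \<gamma> (yd \<delta>) (n \<delta>))) \<longlongrightarrow> 0) (at_right 0)"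
  proof (rule order_tendstoI)
    fix \<epsilon> :: real assume "0 < \<epsilon>"
    then obtain v where "gap v < \<epsilon> / c" using gap_arbitrarily_small[of "\<epsilon> / c"] c by auto
    then have "c * gap v < \<epsilon>" using c by (simp add: field_simps)
    from order_tendstoD(2)[OF lim this] bound[of v]
    show "\<forall>\<^sub>F \<delta> in at_right 0. gap (dual_iter \<Omega> A \<gamma> (yd \<delta>) (n \<delta>)) < \<epsilon>"
      by eventually_elim simp
  next
    fix \<epsilon> :: real assume "\<epsilon> < 0"
    then show "\<forall>\<^sub>F \<delta> in at_right 0. \<epsilon> < gap (dual_iter \<Omega> A \<gamma> (yd \<delta>) (n \<delta>))"
      by (intro always_eventually allI order.strict_trans2[OF _ gap_nonneg])
  qed
  then have "((\<lambda>\<delta>. sqrt (2 * gap (dual_iter \<Omega> A \<gamma> (yd \<delta>) (n \<delta>)))) \<longlongrightarrow> sqrt (2 * 0)) (at_right 0)"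
    by (intro tendsto_intros)
  then have upper: "((\<lambda>\<delta>. sqrt (2 * gap (dual_iter \<Omega> A \<gamma> (yd \<delta>) (n \<delta>)))) \<longlongrightarrow> 0) (at_right 0)"
    by simp
  show ?thesis
    by (rule tendsto_sandwich[OF _ _ tendsto_const upper];
        intro always_eventually allI error_le L1_norm_nonneg)
qed

lemma error_rate:
  assumes "gap (dual_iter \<Omega> A \<gamma> yd n) \<le> C * \<delta>" "0 < \<delta>"
  shows "L1_norm \<Omega> (\<lambda>t. primal_iter \<Omega> A \<gamma> yd n t - xdag t) \<le> sqrt (2 * C) * \<delta> powr (1 / 2)"
proof -
  have "sqrt (2 * gap (dual_iter \<Omega> A \<gamma> yd n)) \<le> sqrt (2 * C * \<delta>)" using assms by simp
  also have "\<dots> = sqrt (2 * C) * \<delta> powr (1 / 2)" using assms by (simp add: real_sqrt_mult powr_half_sqrt)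
  finally show ?thesis using error_le order_trans by blast
qed

lemma a_priori_convergence:
  fixes n :: "real \<Rightarrow> nat" and yd :: "real \<Rightarrow> 'b"
  assumes \<gamma>: "0 < \<gamma>" "\<gamma> * opnorm\<^sup>2 \<le> 1" and yd: "\<forall>\<delta>>0. norm (yd \<delta> - y) \<le> \<delta>"
    and n: "filterlim n at_top (at_right 0)" and nd: "((\<lambda>\<delta>. \<delta>\<^sup>2 * real (n \<delta>)) \<longlongrightarrow> 0) (at_right 0)"
  shows "((\<lambda>\<delta>. L1_norm \<Omega> (\<lambda>t. primal_iter \<Omega> A \<gamma> (yd \<delta>) (n \<delta>) t - xdag t)) \<longlongrightarrow> 0) (at_right 0)"
proof (rule error_tendsto_0)
  fix v :: 'b
  define B where "B v \<delta> = gap v + (norm v)\<^sup>2 / (2 * \<gamma>) * inverse (real (n \<delta>)) + \<gamma> / 2 * (\<delta>\<^sup>2 * real (n \<delta>))" for v :: 'b and \<delta>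
  have "\<forall>\<^sub>F \<delta> in at_right 0. 0 < n \<delta>"
    using n[unfolded filterlim_at_top, rule_format, of 1] by (simp add: Suc_le_eq)
  then show "\<forall>\<^sub>F \<delta> in at_right 0. gap (dual_iter \<Omega> A \<gamma> (yd \<delta>) (n \<delta>)) \<le> B v \<delta>"
    using eventually_at_right_less[of 0]
  proof eventually_elim
    case (elim \<delta>)
    interpret noisy_gradient_descent gap grad "opnorm\<^sup>2" \<gamma> \<delta> "yd \<delta> - y" "dual_iter \<Omega> A \<gamma> (yd \<delta>)"
      using dual_iter_noisy_gradient_descent \<gamma> yd elim by blast
    show ?case
      using a_priori_estimate[of "n \<delta>" v] elim \<gamma>(1)
      by (simp add: B_def field_simps power2_eq_square)
  qed
  have "((\<lambda>\<delta>. inverse (real (n \<delta>))) \<longlongrightarrow> 0) (at_right 0)"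
    by (intro tendsto_inverse_0_at_top filterlim_compose[OF filterlim_real_sequentially n])
  then have "(B v \<longlongrightarrow> gap v + (norm v)\<^sup>2 / (2 * \<gamma>) * 0 + \<gamma> / 2 * 0) (at_right 0)"
    unfolding B_def by (intro tendsto_intros nd)
  then show "(B v \<longlongrightarrow> 1 * gap v) (at_right 0)" by simp
qed simp

lemma a_priori_rate:
  assumes \<gamma>: "0 < \<gamma>" "\<gamma> * opnorm\<^sup>2 \<le> 1" and source: "source_condition \<Omega> A xdag"
    and order: "\<exists>c1>0. \<exists>c2>0. \<forall>\<^sub>F \<delta> in at_right 0. c1 / \<delta> \<le> real (n \<delta>) \<and> real (n \<delta>) \<le> c2 / \<delta>"
  shows "\<exists>C. \<forall>\<^sub>F \<delta> in at_right 0. \<forall>yd. norm (yd - y) \<le> \<delta> \<longrightarrow>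
           L1_norm \<Omega> (\<lambda>t. primal_iter \<Omega> A \<gamma> yd (n \<delta>) t - xdag t) \<le> C * \<delta> powr (1 / 2)"
proof -
  obtain v where v: "gap v = 0" using source_condition_imp_gap_zero[OF source] .
  obtain c1 c2 where c: "0 < c1" "0 < c2"
    and n: "\<forall>\<^sub>F \<delta> in at_right 0. c1 / \<delta> \<le> real (n \<delta>) \<and> real (n \<delta>) \<le> c2 / \<delta>"
    using order by blast
  define C where "C = (norm v)\<^sup>2 / (2 * \<gamma> * c1) + \<gamma> * c2 / 2"
  have "\<forall>\<^sub>F \<delta> in at_right 0. \<forall>yd. norm (yd - y) \<le> \<delta> \<longrightarrow>
           L1_norm \<Omega> (\<lambda>t. primal_iter \<Omega> A \<gamma> yd (n \<delta>) t - xdag t) \<le> sqrt (2 * C) * \<delta> powr (1 / 2)"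
    using n eventually_at_right_less[of 0]
  proof eventually_elim
    case (elim \<delta>)
    show ?case
    proof (intro allI impI error_rate)
      fix yd assume yd: "norm (yd - y) \<le> \<delta>"
      interpret noisy_gradient_descent gap grad "opnorm\<^sup>2" \<gamma> \<delta> "yd - y" "dual_iter \<Omega> A \<gamma> yd"
        using dual_iter_noisy_gradient_descent \<gamma> yd by blast
      let ?n = "real (n \<delta>)" and ?D = "gap (dual_iter \<Omega> A \<gamma> yd (n \<delta>))"
      have npos: "0 < ?n" using elim c by (smt (verit) divide_pos_pos)
      have "?D \<le> (norm v)\<^sup>2 / (2 * \<gamma>) * (1 / ?n) + \<gamma> / 2 * (\<delta>\<^sup>2 * ?n)"
        using a_priori_estimate[of "n \<delta>" v] npos \<gamma>(1) v
        by (simp add: field_simps power2_eq_square)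
      also have "\<dots> \<le> (norm v)\<^sup>2 / (2 * \<gamma>) * (\<delta> / c1) + \<gamma> / 2 * (c2 * \<delta>)"
      proof (intro add_mono mult_left_mono)
        show "1 / ?n \<le> \<delta> / c1" using elim c npos by (simp add: field_simps)
        show "\<delta>\<^sup>2 * ?n \<le> c2 * \<delta>" using elim c by (simp add: field_simps power2_eq_square)
      qed (use \<gamma> in auto)
      also have "\<dots> = C * \<delta>" by (simp add: C_def algebra_simps)
      finally show "?D \<le> C * \<delta>" .
    qed (use elim in simp)
  qed
  then show ?thesis by blast
qed

context
  fixes \<gamma> \<tau> :: real
  assumes \<gamma>: "0 < \<gamma>" and \<tau>: "1 < \<tau>" and \<gamma>\<tau>: "\<gamma> * opnorm\<^sup>2 < 1 - 2 / \<tau>"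
begin

lemma dual_iter_discrepancy:
  assumes "norm (yd - y) \<le> \<delta>"
  shows "noisy_gradient_descent gap grad (opnorm\<^sup>2) \<gamma> \<delta> (yd - y) (dual_iter \<Omega> A \<gamma> yd)"
proof (rule dual_iter_noisy_gradient_descent[OF \<gamma> _ assms])
  have "0 < 2 / \<tau>" using \<tau> by simp
  then show "\<gamma> * opnorm\<^sup>2 \<le> 1" using \<gamma>\<tau> by linarith
qed

lemma discrepancy_index_exists_unique:
  assumes "0 < \<delta>" "norm (yd - y) \<le> \<delta>"
  shows "\<exists>!N. discrepancy_index \<Omega> A \<gamma> \<tau> \<delta> yd N"
proof -
  interpret noisy_gradient_descent gap grad "opnorm\<^sup>2" \<gamma> \<delta> "yd - y" "dual_iter \<Omega> A \<gamma> yd"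
    by (rule dual_iter_discrepancy[OF assms(2)])
  have residual: "A (primal_iter \<Omega> A \<gamma> yd n) - yd = residual n" for n
    by (simp add: residual_def grad_def primal_iter_def)
  define N where "N = (LEAST N. norm (residual N) \<le> \<tau> * \<delta>)"
  have "norm (residual N) \<le> \<tau> * \<delta>" unfolding N_def
    using stopping_index_exists[OF \<tau> \<gamma>\<tau> _ assms(1)] LeastI_ex by simp
  moreover have "\<tau> * \<delta> < norm (residual n)" if "n < N" for n
    using not_less_Least[of n "\<lambda>N. norm (residual N) \<le> \<tau> * \<delta>"] that by (simp add: N_def)
  ultimately have "discrepancy_index \<Omega> A \<gamma> \<tau> \<delta> yd N"
    by (simp add: discrepancy_index_def residual)
  moreover have "m = n" if "discrepancy_index \<Omega> A \<gamma> \<tau> \<delta> yd m" "discrepancy_index \<Omega> A \<gamma> \<tau> \<delta> yd n" for m n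
    using that unfolding discrepancy_index_def by (metis linorder_neqE_nat not_le)
  ultimately show ?thesis by blast
qed

lemma discrepancy_gap:
  assumes "norm (yd - y) \<le> \<delta>" "discrepancy_index \<Omega> A \<gamma> \<tau> \<delta> yd N"
  shows "gap (dual_iter \<Omega> A \<gamma> yd N)
    \<le> (5 * \<tau> + 6) * gap v + (\<tau> + 1) * (5 * \<delta> * norm v + 2 * \<gamma> * \<delta>\<^sup>2)"
proof -
  interpret noisy_gradient_descent gap grad "opnorm\<^sup>2" \<gamma> \<delta> "yd - y" "dual_iter \<Omega> A \<gamma> yd"
    by (rule dual_iter_discrepancy[OF assms(1)])
  have residual: "A (primal_iter \<Omega> A \<gamma> yd n) - yd = residual n" for n
    by (simp add: residual_def grad_def primal_iter_def)
  show ?thesis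
    by (rule discrepancy_estimate[OF \<tau> \<gamma>\<tau>])
       (use assms(2) in \<open>auto simp: discrepancy_index_def residual\<close>)
qed

lemma discrepancy_convergence:
  fixes n :: "real \<Rightarrow> nat" and yd :: "real \<Rightarrow> 'b"
  assumes n: "\<forall>\<delta>>0. norm (yd \<delta> - y) \<le> \<delta> \<and> discrepancy_index \<Omega> A \<gamma> \<tau> \<delta> (yd \<delta>) (n \<delta>)"
  shows "((\<lambda>\<delta>. L1_norm \<Omega> (\<lambda>t. primal_iter \<Omega> A \<gamma> (yd \<delta>) (n \<delta>) t - xdag t)) \<longlongrightarrow> 0) (at_right 0)"
proof (rule error_tendsto_0)
  fix v :: 'b
  define B where "B v \<delta> = (5 * \<tau> + 6) * gap v + (\<tau> + 1) * (5 * \<delta> * norm v + 2 * \<gamma> * \<delta>\<^sup>2)" for v :: 'b and \<delta>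
  show "\<forall>\<^sub>F \<delta> in at_right 0. gap (dual_iter \<Omega> A \<gamma> (yd \<delta>) (n \<delta>)) \<le> B v \<delta>"
    using eventually_at_right_less[of 0] by eventually_elim (use n discrepancy_gap in \<open>simp add: B_def\<close>)
  have "(B v \<longlongrightarrow> (5 * \<tau> + 6) * gap v + (\<tau> + 1) * (5 * 0 * norm v + 2 * \<gamma> * 0\<^sup>2)) (at_right 0)"
    unfolding B_def by (intro tendsto_intros)
  then show "(B v \<longlongrightarrow> (5 * \<tau> + 6) * gap v) (at_right 0)" by simp
qed (use \<tau> in simp)

lemma discrepancy_rate:
  assumes source: "source_condition \<Omega> A xdag"
  shows "\<exists>C. \<forall>\<^sub>F \<delta> in at_right 0. \<forall>yd N.
           norm (yd - y) \<le> \<delta> \<and> discrepancy_index \<Omega> A \<gamma> \<tau> \<delta> yd N \<longrightarrow>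
           L1_norm \<Omega> (\<lambda>t. primal_iter \<Omega> A \<gamma> yd N t - xdag t) \<le> C * \<delta> powr (1 / 2)"
proof -
  obtain v where v: "gap v = 0" using source_condition_imp_gap_zero[OF source] .
  define C where "C = (\<tau> + 1) * (5 * norm v + 2 * \<gamma>)"
  have "\<forall>\<^sub>F \<delta> in at_right 0. \<forall>yd N.
           norm (yd - y) \<le> \<delta> \<and> discrepancy_index \<Omega> A \<gamma> \<tau> \<delta> yd N \<longrightarrow>
           L1_norm \<Omega> (\<lambda>t. primal_iter \<Omega> A \<gamma> yd N t - xdag t) \<le> sqrt (2 * C) * \<delta> powr (1 / 2)"
    using eventually_at_right_real[of 0 1, OF zero_less_one]
  proof eventually_elim
    case (elim \<delta>)
    show ?case
    proof (intro allI impI error_rate)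
      fix yd N assume "norm (yd - y) \<le> \<delta> \<and> discrepancy_index \<Omega> A \<gamma> \<tau> \<delta> yd N"
      then have "gap (dual_iter \<Omega> A \<gamma> yd N) \<le> (\<tau> + 1) * (5 * \<delta> * norm v + 2 * \<gamma> * \<delta>\<^sup>2)"
        using discrepancy_gap[of yd \<delta> N v] v by simp
      also have "\<dots> \<le> (\<tau> + 1) * (5 * \<delta> * norm v + 2 * \<gamma> * \<delta>)"
        using elim \<gamma> \<tau> by (simp add: power2_eq_square)
      also have "\<dots> = C * \<delta>" by (simp add: C_def algebra_simps)
      finally show "gap (dual_iter \<Omega> A \<gamma> yd N) \<le> C * \<delta>" .
    qed (use elim in simp)
  qed
  then show ?thesis by blast
qed

end

end

lemma entropic_problem_of_arg_min:
  fixes \<Omega> :: "'a::euclidean_space set" and A :: "('a \<Rightarrow> real) \<Rightarrow> 'b::real_inner"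
  assumes "bounded_domain \<Omega>" and "bounded_linear_L1 \<Omega> A"
    and feasible: "\<exists>x\<in>L1 \<Omega>. A x = y \<and> entropy_reg \<Omega> x < \<infinity>"
    and xdag: "is_arg_min (entropy_reg \<Omega>) (\<lambda>x. x \<in> L1 \<Omega> \<and> A x = y) xdag"
  shows "entropic_problem \<Omega> A y xdag"
proof -
  interpret entropic_operator \<Omega> A using assms by unfold_locales
  have min: "entropy_reg \<Omega> xdag \<le> entropy_reg \<Omega> x" if "x \<in> L1 \<Omega>" "A x = y" for x
    using xdag that by (auto simp: is_arg_min_def not_less)
  have fin: "finite_entropy xdag"
    using feasible min by (force simp: entropy_reg_eq split: if_splits)
  show ?thesis
  proof unfold_locales
    show "A xdag = y" using xdag by (simp add: is_arg_min_def)
    fix x assume "finite_entropy x" "A x = y"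
    then show "entropy xdag \<le> entropy x"
      using min[of x] fin by (simp add: entropy_reg_eq finite_entropy_def prob_densities_def)
  qed (rule fin)
qed

theorem corollary4p3:
  fixes \<Omega> :: "'a::euclidean_space set"
    and A :: "('a \<Rightarrow> real) \<Rightarrow> 'b::{real_inner,complete_space}"
    and y :: 'b
    and xdag :: "'a \<Rightarrow> real"
  assumes domain: "bounded_domain \<Omega>"
    and A: "bounded_linear_L1 \<Omega> A"
    and feasible: "\<exists>x\<in>L1 \<Omega>. A x = y \<and> entropy_reg \<Omega> x < \<infinity>"
    and xdag: "is_arg_min (entropy_reg \<Omega>) (\<lambda>x. x \<in> L1 \<Omega> \<and> A x = y) xdag"
  shows
    "(\<forall>\<gamma>>0. (L1_onorm \<Omega> A \<noteq> 0 \<longrightarrow> \<gamma> \<le> 1 / (L1_onorm \<Omega> A)\<^sup>2) \<longrightarrow>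
        (\<forall>(n :: real \<Rightarrow> nat) (yd :: real \<Rightarrow> 'b).
            (\<forall>\<delta>>0. norm (yd \<delta> - y) \<le> \<delta>) \<and>
            filterlim n at_top (at_right 0) \<and>
            ((\<lambda>\<delta>. \<delta>\<^sup>2 * real (n \<delta>)) \<longlongrightarrow> 0) (at_right 0) \<longrightarrow>
            ((\<lambda>\<delta>. L1_norm \<Omega> (\<lambda>t. primal_iter \<Omega> A \<gamma> (yd \<delta>) (n \<delta>) t - xdag t)) \<longlongrightarrow> 0)
              (at_right 0)) \<and>
        (source_condition \<Omega> A xdag \<longrightarrow>
          (\<forall>n :: real \<Rightarrow> nat.
            (\<exists>c1>0. \<exists>c2>0. \<forall>\<^sub>F \<delta> in at_right 0. c1 / \<delta> \<le> real (n \<delta>) \<and> real (n \<delta>) \<le> c2 / \<delta>) \<longrightarrow>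
            (\<exists>C. \<forall>\<^sub>F \<delta> in at_right 0. \<forall>yd. norm (yd - y) \<le> \<delta> \<longrightarrow>
               L1_norm \<Omega> (\<lambda>t. primal_iter \<Omega> A \<gamma> yd (n \<delta>) t - xdag t) \<le> C * \<delta> powr (1 / 2)))))
     \<and>
     (\<forall>\<tau>>1. \<forall>\<gamma>>0. 1 - 2 / \<tau> - (L1_onorm \<Omega> A)\<^sup>2 * \<gamma> > 0 \<longrightarrow>
        (\<forall>\<delta>>0. \<forall>yd. norm (yd - y) \<le> \<delta> \<longrightarrow> (\<exists>!N. discrepancy_index \<Omega> A \<gamma> \<tau> \<delta> yd N)) \<and>
        (\<forall>(n :: real \<Rightarrow> nat) (yd :: real \<Rightarrow> 'b).
            (\<forall>\<delta>>0. norm (yd \<delta> - y) \<le> \<delta> \<and> discrepancy_index \<Omega> A \<gamma> \<tau> \<delta> (yd \<delta>) (n \<delta>)) \<longrightarrow>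
            ((\<lambda>\<delta>. L1_norm \<Omega> (\<lambda>t. primal_iter \<Omega> A \<gamma> (yd \<delta>) (n \<delta>) t - xdag t)) \<longlongrightarrow> 0)
              (at_right 0)) \<and>
        (source_condition \<Omega> A xdag \<longrightarrow>
          (\<exists>C. \<forall>\<^sub>F \<delta> in at_right 0. \<forall>yd N.
             norm (yd - y) \<le> \<delta> \<and> discrepancy_index \<Omega> A \<gamma> \<tau> \<delta> yd N \<longrightarrow>
             L1_norm \<Omega> (\<lambda>t. primal_iter \<Omega> A \<gamma> yd N t - xdag t) \<le> C * \<delta> powr (1 / 2))))"
proof -
  interpret entropic_problem \<Omega> A y xdag
    by (rule entropic_problem_of_arg_min[OF assms])
  have i: "\<gamma> * opnorm\<^sup>2 \<le> 1" if "0 < \<gamma>" "opnorm \<noteq> 0 \<longrightarrow> \<gamma> \<le> 1 / opnorm\<^sup>2" for \<gamma>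
    using that by (cases "opnorm = 0") (auto simp: field_simps)
  have ii: "\<gamma> * opnorm\<^sup>2 < 1 - 2 / \<tau>" if "1 - 2 / \<tau> - opnorm\<^sup>2 * \<gamma> > 0" for \<gamma> \<tau>
    using that by (simp add: mult.commute)
  show ?thesis
  proof (intro conjI allI impI, goal_cases)
    case (1 \<gamma> n yd)
    then show ?case by (intro a_priori_convergence i) auto
  next
    case (2 \<gamma> n)
    then show ?case by (intro a_priori_rate i)
  next
    case (3 \<tau> \<gamma> \<delta> yd)
    then show ?case by (intro discrepancy_index_exists_unique ii)
  next
    case (4 \<tau> \<gamma> n yd)
    then show ?case by (intro discrepancy_convergence ii)
  next
    case (5 \<tau> \<gamma>)
    then show ?case by (intro discrepancy_rate ii)
  qed
qed

end
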